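(* Let $(\mathcal{X},\mathcal{F},\mu)$ and $(\mathcal{Y},\mathcal{G},\nu)$ be probability spaces and let $\mathcal{R}$ be the field of subsets of $\mathcal{X}\times\mathcal{Y}$ generated by the measurable rectangles $A\times B$ with $A\in\mathcal{F}$, $B\in\mathcal{G}$. Let $H=\cup_n R_n$ and $K=\cap_n R_n$, where $(R_n)_{n\ge 1}$ is a sequence with $R_n\in\mathcal{R}$ for each $n$. Then $$\alpha^*(H)=\beta^*(H)\quad\text{and}\quad\alpha(K)=\beta(K).$$ In addition, $\alpha(H)=\beta(H)$ provided $H$ can be written as $H=\cup_n(A_n\times B_n)$ with $A_n\in\mathcal{F}$, $B_n\in\mathcal{G}$ for each $n\ge 1$, and $$\mu(\limsup_n A_n)=0\quad\text{or}\quad\nu(\limsup_n B_n)=0,$$ where $\limsup_n A_n=\cap_n\cup_{j>n}A_j$ and $\limsup_n B_n=\cap_n\cup_{j>n}B_j$.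
   Context: Let $\mathcal{H}=\mathcal{F}\otimes\mathcal{G}$ be the product $\sigma$-field on $\mathcal{X}\times\mathcal{Y}$ and $\Gamma(\mu,\nu)$ the set of ($\sigma$-additive) probability measures $P$ on $\mathcal{H}$ with marginals $\mu$ and $\nu$, i.e. $P(A\times\mathcal{Y})=\mu(A)$ and $P(\mathcal{X}\times B)=\nu(B)$ for all $A\in\mathcal{F}$, $B\in\mathcal{G}$. $L_1(\mu)$ is the class of $\mathcal{F}$-measurable, $\mu$-integrable functions $\mathcal{X}\to\mathbb{R}$ (real-valued, not identified when a.s. equal); similarly $L_1(\nu)$. Write $\mu(f)=\int f\,d\mu$, and similarly for $\nu$. For $f:\mathcal{X}\to\mathbb{R}$ and $g:\mathcal{Y}\to\mathbb{R}$, $f+g$ denotes the function $(x,y)\mapsto f(x)+g(y)$ on $\mathcal{X}\times\mathcal{Y}$. Let $L=\{f+g: f\in L_1(\mu),\ g\in L_1(\nu)\}$. For $H\in\mathcal{H}$ define $$\alpha(H)=\inf_{P\in\Gamma(\mu,\nu)}P(H),\qquad \alpha^*(H)=\sup_{P\in\Gamma(\mu,\nu)}P(H),$$ $$\beta(H)=\sup\{\mu(f)+\nu(g): f+g\in L,\ f+g\le 1_H\},\qquad \beta^*(H)=\inf\{\mu(f)+\nu(g): f+g\in L,\ f+g\ge 1_H\},$$ where the inequalities hold everywhere on $\mathcal{X}\times\mathcal{Y}$. *)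

theory Defs
  imports "HOL-Probability.Probability"
begin

definition couplings :: "'a measure \<Rightarrow> 'b measure \<Rightarrow> ('a \<times> 'b) measure set" where
  "couplings \<mu> \<nu> = {P. prob_space P \<and> sets P = sets (\<mu> \<Otimes>\<^sub>M \<nu>) \<and>
     (\<forall>A\<in>sets \<mu>. measure P (A \<times> space \<nu>) = measure \<mu> A) \<and>
     (\<forall>B\<in>sets \<nu>. measure P (space \<mu> \<times> B) = measure \<nu> B)}"

definition rect_field :: "'a measure \<Rightarrow> 'b measure \<Rightarrow> ('a \<times> 'b) set set" where
  "rect_field \<mu> \<nu> =
     (algebra (space \<mu> \<times> space \<nu>)) hull {A \<times> B | A B. A \<in> sets \<mu> \<and> B \<in> sets \<nu>}"

text \<open>
  The following four quantities are real-valued infima and suprema. For probability spaces and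
  measurable \<open>H\<close> they range over nonempty bounded sets of reals, as shown below, so the default
  values of \<open>Inf\<close> and \<open>Sup\<close> on other sets play no role. The pointwise inequalities are
  required everywhere on \<open>space \<mu> \<times> space \<nu>\<close>, not just almost everywhere.
\<close>

definition alpha :: "'a measure \<Rightarrow> 'b measure \<Rightarrow> ('a \<times> 'b) set \<Rightarrow> real" where
  "alpha \<mu> \<nu> H = (INF P\<in>couplings \<mu> \<nu>. measure P H)"

definition alpha_star :: "'a measure \<Rightarrow> 'b measure \<Rightarrow> ('a \<times> 'b) set \<Rightarrow> real" where
  "alpha_star \<mu> \<nu> H = (SUP P\<in>couplings \<mu> \<nu>. measure P H)"

definition beta :: "'a measure \<Rightarrow> 'b measure \<Rightarrow> ('a \<times> 'b) set \<Rightarrow> real" where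
  "beta \<mu> \<nu> H = Sup {integral\<^sup>L \<mu> f + integral\<^sup>L \<nu> g | (f :: 'a \<Rightarrow> real) (g :: 'b \<Rightarrow> real).
     integrable \<mu> f \<and> integrable \<nu> g \<and>
     (\<forall>x\<in>space \<mu>. \<forall>y\<in>space \<nu>. f x + g y \<le> indicator H (x, y))}"

definition beta_star :: "'a measure \<Rightarrow> 'b measure \<Rightarrow> ('a \<times> 'b) set \<Rightarrow> real" where
  "beta_star \<mu> \<nu> H = Inf {integral\<^sup>L \<mu> f + integral\<^sup>L \<nu> g | (f :: 'a \<Rightarrow> real) (g :: 'b \<Rightarrow> real).
     integrable \<mu> f \<and> integrable \<nu> g \<and>
     (\<forall>x\<in>space \<mu>. \<forall>y\<in>space \<nu>. f x + g y \<ge> indicator H (x, y))}"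

lemma pair_measure_in_couplings:
  assumes "prob_space \<mu>" "prob_space \<nu>"
  shows "\<mu> \<Otimes>\<^sub>M \<nu> \<in> couplings \<mu> \<nu>"
proof -
  interpret M: prob_space \<mu> by fact
  interpret N: prob_space \<nu> by fact
  interpret pair_prob_space \<mu> \<nu> ..
  show ?thesis
    by (auto simp: couplings_def prob_space_axioms measure_def N.emeasure_pair_measure_Times
        M.emeasure_space_1 N.emeasure_space_1)
qed

lemma coupling_prob_bounds:
  assumes "P \<in> couplings \<mu> \<nu>"
  shows "0 \<le> measure P H" "measure P H \<le> 1"
  using assms prob_space.prob_le_1 by (auto simp: couplings_def)

lemma rect_field_subset: "rect_field \<mu> \<nu> \<subseteq> sets (\<mu> \<Otimes>\<^sub>M \<nu>)"
proof -
  have "algebra (space \<mu> \<times> space \<nu>) (sets (\<mu> \<Otimes>\<^sub>M \<nu>))"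
    using sets.algebra_axioms[of "\<mu> \<Otimes>\<^sub>M \<nu>"] by (simp add: space_pair_measure)
  then show ?thesis
    unfolding rect_field_def by (intro hull_minimal) auto
qed

lemma integral_pair_sum:
  fixes f :: "'a \<Rightarrow> real" and g :: "'b \<Rightarrow> real"
  assumes "prob_space \<mu>" "prob_space \<nu>" "integrable \<mu> f" "integrable \<nu> g"
  shows "integrable (\<mu> \<Otimes>\<^sub>M \<nu>) (\<lambda>(x, y). f x + g y)"
    and "integral\<^sup>L (\<mu> \<Otimes>\<^sub>M \<nu>) (\<lambda>(x, y). f x + g y) = integral\<^sup>L \<mu> f + integral\<^sup>L \<nu> g"
proof -
  interpret M: prob_space \<mu> by fact
  interpret N: prob_space \<nu> by fact
  interpret pair_prob_space \<mu> \<nu> ..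
  have df: "distr (\<mu> \<Otimes>\<^sub>M \<nu>) \<mu> fst = \<mu>"
    by (rule N.distr_pair_fst)
  have dg: "distr (\<mu> \<Otimes>\<^sub>M \<nu>) \<nu> snd = \<nu>"
  proof (rule measure_eqI)
    fix B assume "B \<in> sets (distr (\<mu> \<Otimes>\<^sub>M \<nu>) \<nu> snd)"
    then have B: "B \<in> sets \<nu>" by simp
    then have "snd -` B \<inter> space (\<mu> \<Otimes>\<^sub>M \<nu>) = space \<mu> \<times> B"
      using sets.sets_into_space by (fastforce simp: space_pair_measure)
    with B show "emeasure (distr (\<mu> \<Otimes>\<^sub>M \<nu>) \<nu> snd) B = emeasure \<nu> B"
      by (simp add: emeasure_distr N.emeasure_pair_measure_Times M.emeasure_space_1)
  qed simp
  have f: "integrable (\<mu> \<Otimes>\<^sub>M \<nu>) (\<lambda>z. f (fst z))"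
    using assms(3) integrable_distr[of fst "\<mu> \<Otimes>\<^sub>M \<nu>" \<mu> f] by (simp add: df)
  have g: "integrable (\<mu> \<Otimes>\<^sub>M \<nu>) (\<lambda>z. g (snd z))"
    using assms(4) integrable_distr[of snd "\<mu> \<Otimes>\<^sub>M \<nu>" \<nu> g] by (simp add: dg)
  have f': "integral\<^sup>L (\<mu> \<Otimes>\<^sub>M \<nu>) (\<lambda>z. f (fst z)) = integral\<^sup>L \<mu> f"
    using assms(3) integral_distr[of fst "\<mu> \<Otimes>\<^sub>M \<nu>" \<mu> f] by (simp add: df)
  have g': "integral\<^sup>L (\<mu> \<Otimes>\<^sub>M \<nu>) (\<lambda>z. g (snd z)) = integral\<^sup>L \<nu> g"
    using assms(4) integral_distr[of snd "\<mu> \<Otimes>\<^sub>M \<nu>" \<nu> g] by (simp add: dg)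
  show "integrable (\<mu> \<Otimes>\<^sub>M \<nu>) (\<lambda>(x, y). f x + g y)"
    using f g by (simp add: case_prod_unfold)
  show "integral\<^sup>L (\<mu> \<Otimes>\<^sub>M \<nu>) (\<lambda>(x, y). f x + g y) = integral\<^sup>L \<mu> f + integral\<^sup>L \<nu> g"
    using f g f' g' by (simp add: case_prod_unfold)
qed

lemma beta_set_bounds:
  fixes \<mu> :: "'a measure" and \<nu> :: "'b measure" and H :: "('a \<times> 'b) set"
  assumes "prob_space \<mu>" "prob_space \<nu>"
  defines "S \<equiv> {integral\<^sup>L \<mu> f + integral\<^sup>L \<nu> g | (f :: 'a \<Rightarrow> real) (g :: 'b \<Rightarrow> real).
     integrable \<mu> f \<and> integrable \<nu> g \<and>
     (\<forall>x\<in>space \<mu>. \<forall>y\<in>space \<nu>. f x + g y \<le> indicator H (x, y))}"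
  shows "0 \<in> S" "bdd_above S"
proof -
  interpret M: prob_space \<mu> by fact
  interpret N: prob_space \<nu> by fact
  interpret pair_prob_space \<mu> \<nu> ..
  show "0 \<in> S"
    unfolding S_def by (intro CollectI exI[of _ "\<lambda>_. 0"]) auto
  have "integral\<^sup>L \<mu> f + integral\<^sup>L \<nu> g \<le> 1"
    if "integrable \<mu> f" "integrable \<nu> g"
      "\<forall>x\<in>space \<mu>. \<forall>y\<in>space \<nu>. f x + g y \<le> indicator H (x, y)" for f g :: "_ \<Rightarrow> real"
  proof -
    have "f x + g y \<le> 1" if "x \<in> space \<mu>" "y \<in> space \<nu>" for x y
      using \<open>\<forall>x\<in>_. _\<close> that indicator_le_1[of H "(x, y)", where 'a=real]
      by (meson order_trans)
    then have "integral\<^sup>L (\<mu> \<Otimes>\<^sub>M \<nu>) (\<lambda>(x, y). f x + g y) \<le> integral\<^sup>L (\<mu> \<Otimes>\<^sub>M \<nu>) (\<lambda>_. 1)"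
      using integral_pair_sum(1)[OF assms(1,2) that(1,2)]
      by (intro integral_mono) (auto simp: space_pair_measure)
    then show ?thesis
      using integral_pair_sum(2)[OF assms(1,2) that(1,2)] by (simp add: prob_space)
  qed
  then show "bdd_above S"
    unfolding S_def bdd_above_def by blast
qed

lemma beta_star_set_bounds:
  fixes \<mu> :: "'a measure" and \<nu> :: "'b measure" and H :: "('a \<times> 'b) set"
  assumes "prob_space \<mu>" "prob_space \<nu>"
  defines "S \<equiv> {integral\<^sup>L \<mu> f + integral\<^sup>L \<nu> g | (f :: 'a \<Rightarrow> real) (g :: 'b \<Rightarrow> real).
     integrable \<mu> f \<and> integrable \<nu> g \<and>
     (\<forall>x\<in>space \<mu>. \<forall>y\<in>space \<nu>. f x + g y \<ge> indicator H (x, y))}"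
  shows "1 \<in> S" "bdd_below S"
proof -
  interpret M: prob_space \<mu> by fact
  interpret N: prob_space \<nu> by fact
  interpret pair_prob_space \<mu> \<nu> ..
  show "1 \<in> S"
    unfolding S_def
    by (intro CollectI exI[of _ "\<lambda>_. 1"] exI[of _ "\<lambda>_. 0"])
      (auto simp: M.prob_space indicator_def)
  have "0 \<le> integral\<^sup>L \<mu> f + integral\<^sup>L \<nu> g"
    if "integrable \<mu> f" "integrable \<nu> g"
      "\<forall>x\<in>space \<mu>. \<forall>y\<in>space \<nu>. f x + g y \<ge> indicator H (x, y)" for f g :: "_ \<Rightarrow> real"
  proof -
    have "0 \<le> f x + g y" if "x \<in> space \<mu>" "y \<in> space \<nu>" for x y
      using \<open>\<forall>x\<in>_. _\<close> that indicator_pos_le[of H "(x, y)", where 'a=real]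
      by (meson order_trans)
    then have "0 \<le> integral\<^sup>L (\<mu> \<Otimes>\<^sub>M \<nu>) (\<lambda>(x, y). f x + g y)"
      by (intro integral_nonneg_AE AE_I2) (auto simp: space_pair_measure)
    then show ?thesis
      using integral_pair_sum(2)[OF assms(1,2) that(1,2)] by simp
  qed
  then show "bdd_below S"
    unfolding S_def bdd_below_def by blast
qed

end

theory Submission
  imports Defs
begin

text \<open>
  A finite union of rectangles depends on finitely many cells of each factor, so its duality is a
  finite max-flow min-cut statement: some coupling \<open>P\<close> and some cover
  \<open>A \<times> Y \<union> X \<times> B\<close> of \<open>R\<close> satisfy \<open>\<mu> A + \<nu> B \<le> P R\<close>, and conversely every cover costs at
  least \<open>P R\<close>. For \<open>H = \<Union>n. R n\<close> with \<open>R\<close> increasing, take optimal covers \<open>(A n, B n)\<close> of \<open>R n\<close>.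
  If \<open>(C, D)\<close> covers \<open>R (m + 1)\<close>, then \<open>(A m \<inter> C, B m \<union> D)\<close> and \<open>(A m \<union> C, B m \<inter> D)\<close> both cover
  \<open>R m\<close>, and their costs add up to those of \<open>(A m, B m)\<close> and \<open>(C, D)\<close>; optimality of \<open>(A m, B m)\<close>
  shows that the first one costs no more than \<open>(C, D)\<close>. Hence \<open>(liminf A, limsup B)\<close>, which covers
  \<open>H\<close>, costs at most \<open>sup\<^sub>P P H\<close>. Intersections follow by complementation, and in the last claim
  \<open>H\<close> exceeds the union of its first \<open>n\<close> rectangles by a set of uniformly small mass.
\<close>

section \<open>Fractional Hall theorem for finite bipartite graphs\<close>

text \<open>A fractional matching in the bipartite graph \<open>E\<close> that saturates every row.
  Columns may keep spare capacity, since Hall's condition only bounds row demands from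
  above.\<close>

definition subplan ::
    "('i \<times> 'j) set \<Rightarrow> 'i set \<Rightarrow> 'j set \<Rightarrow> ('i \<Rightarrow> real) \<Rightarrow> ('j \<Rightarrow> real) \<Rightarrow> ('i \<Rightarrow> 'j \<Rightarrow> real) \<Rightarrow> bool"
  where "subplan E I J a b q \<longleftrightarrow> (\<forall>i j. 0 \<le> q i j) \<and> (\<forall>i j. q i j \<noteq> 0 \<longrightarrow> (i, j) \<in> E) \<and>
    (\<forall>i\<in>I. (\<Sum>j\<in>J. q i j) = a i) \<and> (\<forall>j\<in>J. (\<Sum>i\<in>I. q i j) \<le> b j)"

text \<open>
  Flow is pushed along an edge \<open>(i, j)\<close> until \<open>i\<close> or \<open>j\<close> is used up or some set \<open>S0\<close> that omits
  \<open>i\<close> has no slack left in the Hall condition; in each case the problem becomes smaller.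
\<close>

lemma fractional_hall:
  fixes a :: "'i \<Rightarrow> real" and b :: "'j \<Rightarrow> real" and E :: "('i \<times> 'j) set"
  assumes "finite I" "finite J"
    and "\<And>i. i \<in> I \<Longrightarrow> 0 \<le> a i" "\<And>j. j \<in> J \<Longrightarrow> 0 \<le> b j"
    and "\<And>S. S \<subseteq> I \<Longrightarrow> sum a S \<le> sum b (J \<inter> E `` S)"
  shows "\<exists>q. subplan E I J a b q"
  using assms
proof (induction "card I + card J" arbitrary: I J a b rule: less_induct)
  case less
  note fin = less.prems(1,2) and a0 = less.prems(3) and b0 = less.prems(4) and hall = less.prems(5)
  \<comment> \<open>\<open>a\<close> and \<open>b\<close> are rebound here and in the next two
    facts, because these are also applied to the residual weights that remain after a push.\<close>
  have remove_row: "\<exists>q. subplan E I J a b q"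
    if i: "i \<in> I" "a i = 0" and a0: "\<And>i. i \<in> I \<Longrightarrow> 0 \<le> a i" and b0: "\<And>j. j \<in> J \<Longrightarrow> 0 \<le> b j"
      and hall: "\<And>S. S \<subseteq> I \<Longrightarrow> sum a S \<le> sum b (J \<inter> E `` S)" for i a b
  proof -
    have "card (I - {i}) + card J < card I + card J"
      using card_Diff1_less[OF fin(1) i(1)] by simp
    then have "\<exists>q. subplan E (I - {i}) J a b q"
      using fin a0 b0 by (intro less.hyps hall) auto
    then obtain q where q: "subplan E (I - {i}) J a b q" by blast
    have "(\<Sum>j\<in>J. if k = i then 0 else q k j) = a k" if "k \<in> I" for k
      using q i that unfolding subplan_def by (cases "k = i") auto
    moreover have "(\<Sum>k\<in>I. if k = i then 0 else q k j) \<le> b j" if "j \<in> J" for j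
      using fin i q that by (simp add: subplan_def sum.remove[of I i])
    ultimately have "subplan E I J a b (\<lambda>k j. if k = i then 0 else q k j)"
      using q unfolding subplan_def by (intro conjI allI ballI) (auto split: if_splits)
    then show ?thesis by blast
  qed
  have remove_col: "\<exists>q. subplan E I J a b q"
    if j: "j \<in> J" "b j = 0" and a0: "\<And>i. i \<in> I \<Longrightarrow> 0 \<le> a i" and b0: "\<And>j. j \<in> J \<Longrightarrow> 0 \<le> b j"
      and hall: "\<And>S. S \<subseteq> I \<Longrightarrow> sum a S \<le> sum b (J \<inter> E `` S)" for j a b
  proof -
    have "card I + card (J - {j}) < card I + card J"
      using card_Diff1_less[OF fin(2) j(1)] by simp
    moreover have "sum a S \<le> sum b ((J - {j}) \<inter> E `` S)" if "S \<subseteq> I" for S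
    proof -
      have "sum b ((J - {j}) \<inter> E `` S) = sum b (J \<inter> E `` S)"
        using j fin by (intro sum.mono_neutral_left) auto
      then show ?thesis using hall[OF that] by simp
    qed
    ultimately have "\<exists>q. subplan E I (J - {j}) a b q"
      using fin a0 b0 by (intro less.hyps) auto
    then obtain q where q: "subplan E I (J - {j}) a b q" by blast
    have "(\<Sum>i\<in>I. if k = j then 0 else q i k) \<le> b k" if "k \<in> J" for k
      using q j that unfolding subplan_def by (cases "k = j") auto
    moreover have "(\<Sum>k\<in>J. if k = j then 0 else q i k) = a i" if "i \<in> I" for i
      using fin j q that by (simp add: subplan_def sum.remove[of J j])
    ultimately have "subplan E I J a b (\<lambda>i k. if k = j then 0 else q i k)"
      using q unfolding subplan_def by (intro conjI allI ballI) (auto split: if_splits)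
    then show ?thesis by blast
  qed
  \<comment> \<open>A tight set \<open>S0\<close> uses up the whole capacity of its neighbourhood
    \<open>T\<close>, so \<open>S0\<close> with \<open>T\<close> and the other rows with the other
    columns are two independent, smaller problems.\<close>
  have split: "\<exists>q. subplan E I J a b q"
    if S0: "S0 \<subseteq> I" "S0 \<noteq> I" "S0 \<noteq> {}" "sum a S0 = sum b (J \<inter> E `` S0)"
      and a0: "\<And>i. i \<in> I \<Longrightarrow> 0 \<le> a i" and b0: "\<And>j. j \<in> J \<Longrightarrow> 0 \<le> b j"
      and hall: "\<And>S. S \<subseteq> I \<Longrightarrow> sum a S \<le> sum b (J \<inter> E `` S)" for S0 a b
  proof -
    define T where "T = J \<inter> E `` S0"
    have T: "T \<subseteq> J" "finite T" "finite S0" using fin S0(1) finite_subset by (auto simp: T_def)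
    have "card S0 < card I" using S0 fin by (meson psubsetI psubset_card_mono)
    moreover have "card T \<le> card J" using T fin by (simp add: card_mono)
    ultimately have "card S0 + card T < card I + card J" by simp
    moreover have "sum a S \<le> sum b (T \<inter> E `` S)" if "S \<subseteq> S0" for S
    proof -
      have "T \<inter> E `` S = J \<inter> E `` S" using that by (auto simp: T_def)
      then show ?thesis using hall[of S] that S0 by auto
    qed
    ultimately have "\<exists>q. subplan E S0 T a b q"
      using T a0 b0 S0(1) by (intro less.hyps) auto
    then obtain q1 where q1: "subplan E S0 T a b q1" by blast
    have "card (I - S0) < card I" using S0 fin by (intro psubset_card_mono) auto
    moreover have "card (J - T) \<le> card J" using T fin by (simp add: card_mono)
    ultimately have "card (I - S0) + card (J - T) < card I + card J" by simp
    moreover have "sum a S \<le> sum b ((J - T) \<inter> E `` S)" if "S \<subseteq> I - S0" for S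
    proof -
      \<comment> \<open>Apply the Hall condition to \<open>S \<union> S0\<close> and cancel the
        equality that makes \<open>S0\<close> tight.\<close>
      have "sum a S + sum a S0 = sum a (S \<union> S0)"
        using that fin T finite_subset[of S I] by (intro sum.union_disjoint[symmetric]) auto
      also have "\<dots> \<le> sum b (J \<inter> E `` (S \<union> S0))" using that S0 by (intro hall) auto
      also have "J \<inter> E `` (S \<union> S0) = ((J - T) \<inter> E `` S) \<union> T" by (auto simp: T_def)
      also have "sum b \<dots> = sum b ((J - T) \<inter> E `` S) + sum b T"
        using fin T by (intro sum.union_disjoint) auto
      finally show ?thesis using S0(4) by (simp add: T_def)
    qed
    ultimately have "\<exists>q. subplan E (I - S0) (J - T) a b q"
      using fin a0 b0 by (intro less.hyps) auto
    then obtain q2 where q2: "subplan E (I - S0) (J - T) a b q2" by blast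
    let ?q = "\<lambda>i j. if i \<in> S0 \<and> j \<in> T then q1 i j else if i \<in> I - S0 \<and> j \<in> J - T then q2 i j else 0"
    have J: "J = T \<union> (J - T)" and I: "I = S0 \<union> (I - S0)" using T S0 by auto
    have "(\<Sum>j\<in>J. ?q i j) = a i" if "i \<in> I" for i
    proof -
      have "(\<Sum>j\<in>J. ?q i j) = (\<Sum>j\<in>T. ?q i j) + (\<Sum>j\<in>J-T. ?q i j)"
        by (subst J, subst sum.union_disjoint) (use fin T in auto)
      also have "\<dots> = (if i \<in> S0 then (\<Sum>j\<in>T. q1 i j) else (\<Sum>j\<in>J-T. q2 i j))"
        using that by (auto intro!: sum.neutral)
      also have "\<dots> = a i" using q1 q2 that by (auto simp: subplan_def)
      finally show ?thesis .
    qed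
    moreover have "(\<Sum>i\<in>I. ?q i j) \<le> b j" if "j \<in> J" for j
    proof -
      have "(\<Sum>i\<in>I. ?q i j) = (\<Sum>i\<in>S0. ?q i j) + (\<Sum>i\<in>I-S0. ?q i j)"
        by (subst I, subst sum.union_disjoint) (use fin T in auto)
      also have "\<dots> = (if j \<in> T then (\<Sum>i\<in>S0. q1 i j) else (\<Sum>i\<in>I-S0. q2 i j))"
        using that by (auto intro!: sum.neutral)
      also have "\<dots> \<le> b j" using q1 q2 that by (auto simp: subplan_def)
      finally show ?thesis .
    qed
    ultimately have "subplan E I J a b ?q" using q1 q2 unfolding subplan_def by (intro conjI allI ballI) (auto split: if_splits)
    then show ?thesis by blast
  qed
  show ?case
  proof (cases "\<exists>i\<in>I. a i = 0")
    case True
    then show ?thesis using remove_row a0 b0 hall by blast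
  next
    case False
    show ?thesis
    proof (cases "I = {}")
      case True
      then show ?thesis using b0 by (intro exI[of _ "\<lambda>_ _. 0"]) (auto simp: subplan_def)
    next
      case ne: False
      then obtain i where i: "i \<in> I" by blast
      with False a0 have ai: "a i > 0" by (metis less_eq_real_def)
      have "J \<inter> E `` {i} \<noteq> {}"
        using hall[of "{i}"] i ai by (intro notI) simp
      then obtain j where j: "j \<in> J" "(i, j) \<in> E" by blast
      define D where "D S = sum b (J \<inter> E `` S) - sum a S" for S
      \<comment> \<open>Only these sets lose slack when \<open>t\<close> is pushed along
        \<open>(i, j)\<close>: a set containing \<open>i\<close> has \<open>j\<close> among its
        neighbours, so both sides of its Hall inequality drop by \<open>t\<close>.\<close>
      define F where "F = {S. S \<subseteq> I \<and> i \<notin> S \<and> j \<in> E `` S}"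
      have finF: "finite F" using fin by (auto simp: F_def)
      define M where "M = insert (a i) (insert (b j) (D ` F))"
      define t where "t = Min M"
      have finM: "finite M" "M \<noteq> {}" using finF by (auto simp: M_def)
      have tM: "t \<in> M" unfolding t_def using finM by (rule Min_in)
      have tle: "t \<le> a i" "t \<le> b j" "\<And>S. S \<in> F \<Longrightarrow> t \<le> D S"
        unfolding t_def by (rule Min_le[OF finM(1)]; simp add: M_def)+
      have t0: "0 \<le> t"
        using tM ai b0[OF j(1)] hall by (auto simp: M_def F_def D_def)
      define a' where "a' = a(i := a i - t)"
      define b' where "b' = b(j := b j - t)"
      have a'0: "\<And>k. k \<in> I \<Longrightarrow> 0 \<le> a' k" and b'0: "\<And>k. k \<in> J \<Longrightarrow> 0 \<le> b' k"
        using a0 b0 tle by (auto simp: a'_def b'_def)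
      have suma: "sum a' S = sum a S - (if i \<in> S then t else 0)" if "S \<subseteq> I" for S
      proof -
        have "finite S" using that fin finite_subset by blast
        moreover have "a' = (\<lambda>k. a k - (if k = i then t else 0))" by (auto simp: a'_def)
        ultimately show ?thesis by (simp add: sum_subtractf)
      qed
      have sumb: "sum b' S = sum b S - (if j \<in> S then t else 0)" if "S \<subseteq> J" for S
      proof -
        have "finite S" using that fin finite_subset by blast
        moreover have "b' = (\<lambda>k. b k - (if k = j then t else 0))" by (auto simp: b'_def)
        ultimately show ?thesis by (simp add: sum_subtractf)
      qed
      have hall': "sum a' S \<le> sum b' (J \<inter> E `` S)" if "S \<subseteq> I" for S
        using hall[OF that] tle(3)[of S] t0 that j suma[OF that] sumb[of "J \<inter> E `` S"]
        by (auto simp: F_def D_def split: if_splits)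
      \<comment> \<open>The minimum \<open>t\<close> is attained, so the push exhausts row
        \<open>i\<close> or column \<open>j\<close> or makes some \<open>S\<close> tight. Such an
        \<open>S\<close> is nonempty because \<open>j\<close> is a neighbour of it, and proper
        because it omits \<open>i\<close>.\<close>
      have "\<exists>q. subplan E I J a' b' q"
        using tM unfolding M_def
      proof (elim insertE imageE)
        assume "t = a i"
        then show ?thesis by (intro remove_row[of i] i a'0 b'0 hall') (auto simp: a'_def)
      next
        assume "t = b j"
        then show ?thesis by (intro remove_col[of j] j a'0 b'0 hall') (auto simp: b'_def)
      next
        fix S assume S: "t = D S" "S \<in> F"
        then have "sum a' S = sum b' (J \<inter> E `` S)"
          using suma[of S] sumb[of "J \<inter> E `` S"] j by (auto simp: F_def D_def)
        then show ?thesis using S i by (intro split[of S] a'0 b'0 hall') (auto simp: F_def)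
      qed
      then obtain q where q: "subplan E I J a' b' q" by blast
      \<comment> \<open>The \<open>t\<close> units pushed along \<open>(i, j)\<close> are put back
        on top of the residual solution.\<close>
      define e where "e k l = (if k = i \<and> l = j then t else 0)" for k l
      have "(\<Sum>l\<in>J. e k l) = (if k = i then t else 0)" for k
        using fin j by (simp add: e_def)
      moreover have "(\<Sum>k\<in>I. e k l) = (if l = j then t else 0)" for l
        using fin i by (simp add: e_def)
      ultimately have "(\<forall>k\<in>I. (\<Sum>l\<in>J. q k l + e k l) = a k) \<and> (\<forall>l\<in>J. (\<Sum>k\<in>I. q k l + e k l) \<le> b l)"
        using q by (auto simp: subplan_def sum.distrib a'_def b'_def)
      moreover have "(\<forall>k l. 0 \<le> q k l + e k l) \<and> (\<forall>k l. q k l + e k l \<noteq> 0 \<longrightarrow> (k, l) \<in> E)"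
        using q t0 j by (auto simp: subplan_def e_def)
      ultimately have "subplan E I J a b (\<lambda>k l. q k l + e k l)" by (simp add: subplan_def)
      then show ?thesis by blast
    qed
  qed
qed

section \<open>Max-flow min-cut for finite transport problems\<close>

definition plan :: "'i set \<Rightarrow> 'j set \<Rightarrow> ('i \<Rightarrow> real) \<Rightarrow> ('j \<Rightarrow> real) \<Rightarrow> ('i \<Rightarrow> 'j \<Rightarrow> real) \<Rightarrow> bool"
  where "plan I J a b p \<longleftrightarrow> (\<forall>i\<in>I. \<forall>j\<in>J. 0 \<le> p i j) \<and>
    (\<forall>i\<in>I. (\<Sum>j\<in>J. p i j) = a i) \<and> (\<forall>j\<in>J. (\<Sum>i\<in>I. p i j) = b j)"

text \<open>Hall's condition yields a partial flow inside \<open>E\<close> whose value is at least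
  the minimal cover cost. The unmatched row and column masses, equal in total because
  \<open>sum a I = sum b J\<close>, are then joined by a product.\<close>

lemma finite_transport_duality:
  fixes a :: "'i \<Rightarrow> real" and b :: "'j \<Rightarrow> real" and E :: "('i \<times> 'j) set"
  assumes fin: "finite I" "finite J"
    and a0: "\<And>i. i \<in> I \<Longrightarrow> 0 \<le> a i" and b0: "\<And>j. j \<in> J \<Longrightarrow> 0 \<le> b j"
    and ab: "sum a I = sum b J"
  obtains p S T where "plan I J a b p" "S \<subseteq> I" "T \<subseteq> J" "E \<inter> I \<times> J \<subseteq> S \<times> J \<union> I \<times> T"
    "sum a S + sum b T \<le> (\<Sum>i\<in>I. \<Sum>j\<in>J. if (i, j) \<in> E then p i j else 0)"
proof -
  \<comment> \<open>A cover that leaves out the rows in \<open>S\<close> must contain all columns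
    adjacent to \<open>S\<close>; \<open>cost S\<close> is the price of the cheapest such
    cover.\<close>
  define cost where "cost S = sum a (I - S) + sum b (J \<inter> E `` S)" for S
  define c where "c = Min (cost ` Pow I)"
  have "c \<in> cost ` Pow I"
    unfolding c_def using fin by (intro Min_in) auto
  then obtain S0 where S0: "S0 \<subseteq> I" "c = cost S0" by auto
  have c_le: "c \<le> cost S" if "S \<subseteq> I" for S
    unfolding c_def using fin that by (intro Min_le) auto
  \<comment> \<open>The dummy column \<open>None\<close>, open to every row, absorbs the mass beyond the minimal cover cost \<open>c\<close>;
    with it the Hall condition says exactly that no cover is cheaper than \<open>c\<close>.\<close>
  define E' where "E' = {(i, k). k = None \<or> (\<exists>j. k = Some j \<and> (i, j) \<in> E)}"
  define b' where "b' k = (case k of None \<Rightarrow> sum a I - c | Some j \<Rightarrow> b j)" for k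
  have sum_option: "sum f (insert None (Some ` U)) = f None + (\<Sum>j\<in>U. f (Some j))"
    if "finite U" for f :: "'j option \<Rightarrow> real" and U
    using that by (subst sum.insert) (auto simp: sum.reindex)
  have sum_b': "sum b' (insert None (Some ` U)) = sum a I - c + sum b U" if "finite U" for U
    unfolding sum_option[OF that] by (simp add: b'_def)
  have "\<exists>q. subplan E' I (insert None (Some ` J)) a b' q"
  proof (rule fractional_hall)
    fix k assume "k \<in> insert None (Some ` J)"
    \<comment> \<open>For \<open>None\<close> this is \<open>c \<le> sum a I\<close>, the cost of
      covering by all rows, that is \<open>S = {}\<close>.\<close>
    then show "0 \<le> b' k"
      using b0 c_le[of "{}"] by (auto simp: b'_def cost_def)
  next
    fix S assume S: "S \<subseteq> I"
    show "sum a S \<le> sum b' (insert None (Some ` J) \<inter> E' `` S)"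
    proof (cases "S = {}")
      case False
      then have "insert None (Some ` J) \<inter> E' `` S = insert None (Some ` (J \<inter> E `` S))"
        by (auto simp: E'_def)
      then have "sum b' (insert None (Some ` J) \<inter> E' `` S) = sum a I - c + sum b (J \<inter> E `` S)"
        using fin by (simp add: sum_b' del: sum.insert)
      moreover have "sum a I = sum a S + sum a (I - S)"
        using S fin by (metis sum.subset_diff add.commute)
      ultimately show ?thesis
        using c_le[OF S] by (simp add: cost_def)
    qed simp
  qed (use fin a0 in auto)
  then obtain q' where q': "subplan E' I (insert None (Some ` J)) a b' q'" by blast
  define q where "q i j = q' i (Some j)" for i j
  have q0: "0 \<le> q i j" and qE: "(i, j) \<notin> E \<Longrightarrow> q i j = 0" for i j
    using q' by (auto simp: subplan_def q_def E'_def)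
  define r where "r i = a i - (\<Sum>j\<in>J. q i j)" for i
  define s where "s j = b j - (\<Sum>i\<in>I. q i j)" for j
  have r: "r i = q' i None" if "i \<in> I" for i
    using q' that fin by (auto simp: subplan_def r_def q_def sum.reindex o_def)
  then have r0: "0 \<le> r i" if "i \<in> I" for i
    using q' that by (auto simp: subplan_def)
  have s0: "0 \<le> s j" if "j \<in> J" for j
    using q' that by (auto simp: subplan_def s_def q_def b'_def)
  define d where "d = sum r I"
  \<comment> \<open>The dummy column holds at most \<open>sum a I - c\<close>, so the genuine
    columns receive at least \<open>c\<close>.\<close>
  have "d \<le> sum a I - c"
    using q' by (auto simp: d_def r subplan_def b'_def)
  then have q_ge: "c \<le> (\<Sum>i\<in>I. \<Sum>j\<in>J. q i j)"
    by (simp add: d_def r_def sum_subtractf)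
  have ds: "d = sum s J"
    unfolding d_def r_def s_def sum_subtractf ab by (subst sum.swap) simp
  have d0: "0 \<le> d" using r0 by (simp add: d_def sum_nonneg)
  \<comment> \<open>If \<open>d = 0\<close>, then \<open>r\<close> and \<open>s\<close> vanish, so the quotient \<open>x / 0 = 0\<close> is the right value.\<close>
  define p where "p i j = q i j + r i * s j / d" for i j
  have rd: "r i * d / d = r i" if "i \<in> I" for i
    using sum_nonneg_eq_0_iff[OF fin(1) r0] that by (auto simp: d_def)
  have sd: "d * s j / d = s j" if "j \<in> J" for j
    using sum_nonneg_eq_0_iff[OF fin(2) s0] that by (auto simp: ds)
  have "plan I J a b p"
    unfolding plan_def
  proof (intro conjI ballI)
    fix i j assume "i \<in> I" "j \<in> J"
    then show "0 \<le> p i j" using q0 r0 s0 d0 by (simp add: p_def)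
  next
    fix i assume i: "i \<in> I"
    have "(\<Sum>j\<in>J. p i j) = (\<Sum>j\<in>J. q i j) + r i * d / d"
      by (simp add: p_def sum.distrib ds sum_distrib_left sum_divide_distrib)
    then show "(\<Sum>j\<in>J. p i j) = a i" using rd[OF i] by (simp add: r_def)
  next
    fix j assume j: "j \<in> J"
    have "(\<Sum>i\<in>I. p i j) = (\<Sum>i\<in>I. q i j) + d * s j / d"
      by (simp add: p_def sum.distrib d_def sum_distrib_right sum_divide_distrib)
    then show "(\<Sum>i\<in>I. p i j) = b j" using sd[OF j] by (simp add: s_def)
  qed
  moreover have "E \<inter> I \<times> J \<subseteq> (I - S0) \<times> J \<union> I \<times> (J \<inter> E `` S0)" by auto
  moreover have "sum a (I - S0) + sum b (J \<inter> E `` S0) \<le> (\<Sum>i\<in>I. \<Sum>j\<in>J. if (i, j) \<in> E then p i j else 0)"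
  proof -
    \<comment> \<open>The product term is nonnegative, so completing the marginals can only raise
      the mass on \<open>E\<close>.\<close>
    have "(\<Sum>i\<in>I. \<Sum>j\<in>J. q i j) \<le> (\<Sum>i\<in>I. \<Sum>j\<in>J. if (i, j) \<in> E then p i j else 0)"
      using q0 qE r0 s0 d0 by (intro sum_mono) (auto simp: p_def)
    then show ?thesis using q_ge S0 by (simp add: cost_def)
  qed
  ultimately show thesis by (intro that[of p "I - S0" "J \<inter> E `` S0"]) auto
qed

section \<open>The algebra of sets built from finitely many cells\<close>

text \<open>Unions of cells of a finite product partition, the partitions being encoded by labelling
  functions. Labels are natural numbers so that two labellings merge into one by
  \<open>prod_encode\<close>.\<close>

definition grid :: "'a measure \<Rightarrow> 'b measure \<Rightarrow> ('a \<times> 'b) set set" where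
  "grid \<mu> \<nu> = {{(x, y) \<in> space \<mu> \<times> space \<nu>. (s x, t y) \<in> E} | (s :: 'a \<Rightarrow> nat) (t :: 'b \<Rightarrow> nat) E.
     s \<in> measurable \<mu> (count_space UNIV) \<and> finite (s ` space \<mu>) \<and>
     t \<in> measurable \<nu> (count_space UNIV) \<and> finite (t ` space \<nu>)}"

lemma gridI:
  fixes s :: "'a \<Rightarrow> nat" and t :: "'b \<Rightarrow> nat"
  assumes "R = {(x, y) \<in> space \<mu> \<times> space \<nu>. (s x, t y) \<in> E}"
    and "s \<in> measurable \<mu> (count_space UNIV)" "finite (s ` space \<mu>)"
    and "t \<in> measurable \<nu> (count_space UNIV)" "finite (t ` space \<nu>)"
  shows "R \<in> grid \<mu> \<nu>"
  unfolding grid_def using assms by blast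

lemma Times_in_grid:
  assumes AB: "A \<in> sets \<mu>" "B \<in> sets \<nu>"
  shows "A \<times> B \<in> grid \<mu> \<nu>"
proof -
  define s :: "'a \<Rightarrow> nat" where "s x = (if x \<in> A then 1 else 0)" for x
  define t :: "'b \<Rightarrow> nat" where "t y = (if y \<in> B then 1 else 0)" for y
  show ?thesis
  proof (rule gridI)
    show "A \<times> B = {(x, y) \<in> space \<mu> \<times> space \<nu>. (s x, t y) \<in> {(1, 1)}}"
      using AB[THEN sets.sets_into_space] by (auto simp: s_def t_def split: if_splits)
    show "s \<in> measurable \<mu> (count_space UNIV)" "t \<in> measurable \<nu> (count_space UNIV)"
      using AB unfolding s_def t_def by measurable
    show "finite (s ` space \<mu>)" "finite (t ` space \<nu>)"
      by (rule finite_subset[of _ "{0, 1}"]; auto simp: s_def t_def)+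
  qed
qed

text \<open>A complement keeps the labellings and complements \<open>E\<close>; for a union, both
  sets are described over the common refinement of their partitions.\<close>

lemma algebra_grid: "algebra (space \<mu> \<times> space \<nu>) (grid \<mu> \<nu>)"
  unfolding algebra_iff_Un
proof (intro conjI ballI)
  show "grid \<mu> \<nu> \<subseteq> Pow (space \<mu> \<times> space \<nu>)" by (auto simp: grid_def)
  have "{} = {(x, y) \<in> space \<mu> \<times> space \<nu>. ((\<lambda>_. 0 :: nat) x, (\<lambda>_. 0 :: nat) y) \<in> {}}" by simp
  then show "{} \<in> grid \<mu> \<nu>"
    by (rule gridI) (auto simp: image_constant_conv)
next
  fix R assume "R \<in> grid \<mu> \<nu>"
  then obtain s t E where R: "R = {(x, y) \<in> space \<mu> \<times> space \<nu>. (s x, t y) \<in> E}"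
    and st: "s \<in> measurable \<mu> (count_space (UNIV :: nat set))" "finite (s ` space \<mu>)"
      "t \<in> measurable \<nu> (count_space (UNIV :: nat set))" "finite (t ` space \<nu>)"
    by (auto simp: grid_def)
  have "space \<mu> \<times> space \<nu> - R = {(x, y) \<in> space \<mu> \<times> space \<nu>. (s x, t y) \<in> - E}"
    by (auto simp: R)
  then show "space \<mu> \<times> space \<nu> - R \<in> grid \<mu> \<nu>"
    by (rule gridI) (fact st)+
next
  fix R R' assume "R \<in> grid \<mu> \<nu>" "R' \<in> grid \<mu> \<nu>"
  then obtain s t E s' t' E' where R: "R = {(x, y) \<in> space \<mu> \<times> space \<nu>. (s x, t y) \<in> E}"
    "R' = {(x, y) \<in> space \<mu> \<times> space \<nu>. (s' x, t' y) \<in> E'}"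
    and st: "s \<in> measurable \<mu> (count_space (UNIV :: nat set))" "finite (s ` space \<mu>)"
      "t \<in> measurable \<nu> (count_space (UNIV :: nat set))" "finite (t ` space \<nu>)"
    and st': "s' \<in> measurable \<mu> (count_space (UNIV :: nat set))" "finite (s' ` space \<mu>)"
      "t' \<in> measurable \<nu> (count_space (UNIV :: nat set))" "finite (t' ` space \<nu>)"
    unfolding grid_def by blast
  have meas: "(\<lambda>x. prod_encode (u x, v x)) \<in> measurable M (count_space UNIV)"
    if [measurable]: "u \<in> measurable M (count_space UNIV)" "v \<in> measurable M (count_space UNIV)"
    for u v :: "'c \<Rightarrow> nat" and M
    by measurable
  have fin: "finite ((\<lambda>x. prod_encode (u x, v x)) ` X)"
    if "finite (u ` X)" "finite (v ` X)" for u v :: "'c \<Rightarrow> nat" and X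
    by (rule finite_subset[of _ "prod_encode ` (u ` X \<times> v ` X)"]) (use that in auto)
  let ?s = "\<lambda>x. prod_encode (s x, s' x)" and ?t = "\<lambda>y. prod_encode (t y, t' y)"
  let ?E = "{(k, l). (fst (prod_decode k), fst (prod_decode l)) \<in> E \<or>
    (snd (prod_decode k), snd (prod_decode l)) \<in> E'}"
  show "R \<union> R' \<in> grid \<mu> \<nu>"
  proof (rule gridI)
    show "R \<union> R' = {(x, y) \<in> space \<mu> \<times> space \<nu>. (?s x, ?t y) \<in> ?E}"
      by (auto simp: R)
  qed (fact meas[OF st(1) st'(1)] fin[OF st(2) st'(2)] meas[OF st(3) st'(3)] fin[OF st(4) st'(4)])+
qed

lemma rect_field_subset_grid: "rect_field \<mu> \<nu> \<subseteq> grid \<mu> \<nu>"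
  unfolding rect_field_def using algebra_grid Times_in_grid by (intro hull_minimal) auto

lemma grid_subset_sets: "grid \<mu> \<nu> \<subseteq> sets (\<mu> \<Otimes>\<^sub>M \<nu>)"
proof
  fix R assume "R \<in> grid \<mu> \<nu>"
  then obtain s t E where R: "R = {(x, y) \<in> space \<mu> \<times> space \<nu>. (s x, t y) \<in> E}"
    and [measurable]: "s \<in> measurable \<mu> (count_space (UNIV :: nat set))"
      "t \<in> measurable \<nu> (count_space (UNIV :: nat set))"
    by (auto simp: grid_def)
  have "R = {z \<in> space (\<mu> \<Otimes>\<^sub>M \<nu>). (s (fst z), t (snd z)) \<in> E}"
    by (auto simp: R space_pair_measure)
  also have "\<dots> \<in> sets (\<mu> \<Otimes>\<^sub>M \<nu>)" by measurable
  finally show "R \<in> sets (\<mu> \<Otimes>\<^sub>M \<nu>)" .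
qed

section \<open>From finite transport plans to couplings and covers\<close>

text \<open>Spread the mass \<open>p i j\<close> over the cell with labels \<open>i\<close> and
  \<open>j\<close> in proportion to the product measure. Within a cell the marginals are then
  proportional to \<open>\<mu>\<close> and \<open>\<nu>\<close>, and the row and column sums of
  \<open>p\<close> fix the factors.\<close>

lemma coupling_of_plan:
  fixes s :: "'a \<Rightarrow> 'i" and t :: "'b \<Rightarrow> 'j"
  assumes "prob_space \<mu>" "prob_space \<nu>"
    and [measurable]: "s \<in> measurable \<mu> (count_space UNIV)" "t \<in> measurable \<nu> (count_space UNIV)"
    and fin: "finite (s ` space \<mu>)" "finite (t ` space \<nu>)"
    and p: "plan (s ` space \<mu>) (t ` space \<nu>) (\<lambda>i. measure \<mu> (s -` {i} \<inter> space \<mu>))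
      (\<lambda>j. measure \<nu> (t -` {j} \<inter> space \<nu>)) p"
  obtains P where "P \<in> couplings \<mu> \<nu>"
    "\<And>E. measure P {(x, y) \<in> space \<mu> \<times> space \<nu>. (s x, t y) \<in> E} =
      (\<Sum>i\<in>s ` space \<mu>. \<Sum>j\<in>t ` space \<nu>. if (i, j) \<in> E then p i j else 0)"
proof -
  interpret M: prob_space \<mu> by fact
  interpret N: prob_space \<nu> by fact
  interpret pair_prob_space \<mu> \<nu> ..
  define I where "I = s ` space \<mu>"
  define J where "J = t ` space \<nu>"
  define U where "U i = s -` {i} \<inter> space \<mu>" for i
  define V where "V j = t -` {j} \<inter> space \<nu>" for j
  define a where "a i = measure \<mu> (U i)" for i
  define b where "b j = measure \<nu> (V j)" for j
  have finI: "finite I" "finite J" using fin by (auto simp: I_def J_def)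
  have UV [measurable]: "U i \<in> sets \<mu>" "V j \<in> sets \<nu>" for i j
    unfolding U_def V_def by measurable
  have p0: "0 \<le> p i j" and row: "(\<Sum>j\<in>J. p i j) = a i" and col: "(\<Sum>i\<in>I. p i j) = b j"
    if "i \<in> I" "j \<in> J" for i j
    using p that by (auto simp: plan_def I_def J_def a_def b_def U_def V_def)
  have pa: "p i j = 0" if "i \<in> I" "j \<in> J" "a i = 0" for i j
    using row[OF that(1,2)] sum_nonneg_eq_0_iff[OF finI(2), of "p i"] p0 that by simp
  have pb: "p i j = 0" if "i \<in> I" "j \<in> J" "b j = 0" for i j
    using col[OF that(1,2)] sum_nonneg_eq_0_iff[OF finI(1), of "\<lambda>i. p i j"] p0 that by simp
  \<comment> \<open>Null cells carry no mass of \<open>p\<close>, so the junk value at \<open>a i * b j = 0\<close> is harmless.\<close>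
  define c where "c i j = p i j / (a i * b j)" for i j
  have c0: "0 \<le> c i j" if "i \<in> I" "j \<in> J" for i j
    using p0[OF that] by (simp add: c_def a_def b_def)
  have cab: "c i j * (a i * b j) = p i j" if "i \<in> I" "j \<in> J" for i j
    using pa[OF that] pb[OF that] by (auto simp: c_def)
  define h where "h z = (\<Sum>i\<in>I. \<Sum>j\<in>J. c i j * indicator (U i \<times> V j) z)" for z :: "'a \<times> 'b"
  have [measurable]: "h \<in> borel_measurable (\<mu> \<Otimes>\<^sub>M \<nu>)" unfolding h_def by measurable
  define P where "P = density (\<mu> \<Otimes>\<^sub>M \<nu>) (\<lambda>z. ennreal (h z))"
  have eP: "emeasure P X = ennreal (\<Sum>i\<in>I. \<Sum>j\<in>J. c i j * measure (\<mu> \<Otimes>\<^sub>M \<nu>) (U i \<times> V j \<inter> X))"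
    if X [measurable]: "X \<in> sets (\<mu> \<Otimes>\<^sub>M \<nu>)" for X
  proof -
    have int: "integrable (\<mu> \<Otimes>\<^sub>M \<nu>) (\<lambda>z. c i j * indicator (U i \<times> V j \<inter> X) z :: real)" for i j
      by (intro integrable_mult_right integrable_real_indicator) (auto simp: less_top[symmetric])
    have "emeasure P X = (\<integral>\<^sup>+z. ennreal (h z) * indicator X z \<partial>(\<mu> \<Otimes>\<^sub>M \<nu>))"
      unfolding P_def by (rule emeasure_density) auto
    also have "\<dots> = (\<integral>\<^sup>+z. ennreal (\<Sum>i\<in>I. \<Sum>j\<in>J. c i j * indicator (U i \<times> V j \<inter> X) z) \<partial>(\<mu> \<Otimes>\<^sub>M \<nu>))"
      by (intro nn_integral_cong) (auto simp: h_def indicator_def split: if_splits)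
    also have "\<dots> = ennreal (\<integral>z. (\<Sum>i\<in>I. \<Sum>j\<in>J. c i j * indicator (U i \<times> V j \<inter> X) z) \<partial>(\<mu> \<Otimes>\<^sub>M \<nu>))"
    proof (rule nn_integral_eq_integral)
      show "integrable (\<mu> \<Otimes>\<^sub>M \<nu>) (\<lambda>z. \<Sum>i\<in>I. \<Sum>j\<in>J. c i j * indicator (U i \<times> V j \<inter> X) z)"
        by (intro Bochner_Integration.integrable_sum int)
      show "AE z in \<mu> \<Otimes>\<^sub>M \<nu>. 0 \<le> (\<Sum>i\<in>I. \<Sum>j\<in>J. c i j * indicator (U i \<times> V j \<inter> X) z)"
        by (intro AE_I2 sum_nonneg mult_nonneg_nonneg c0) auto
    qed
    also have "(\<integral>z. (\<Sum>i\<in>I. \<Sum>j\<in>J. c i j * indicator (U i \<times> V j \<inter> X) z) \<partial>(\<mu> \<Otimes>\<^sub>M \<nu>)) =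
        (\<Sum>i\<in>I. \<Sum>j\<in>J. \<integral>z. c i j * indicator (U i \<times> V j \<inter> X) z \<partial>(\<mu> \<Otimes>\<^sub>M \<nu>))"
      by (simp only: Bochner_Integration.integral_sum Bochner_Integration.integrable_sum int)
    also have "\<dots> = (\<Sum>i\<in>I. \<Sum>j\<in>J. c i j * measure (\<mu> \<Otimes>\<^sub>M \<nu>) (U i \<times> V j \<inter> X))"
      by (simp add: sets.Int_space_eq2)
    finally show ?thesis .
  qed
  have mP: "measure P X = (\<Sum>i\<in>I. \<Sum>j\<in>J. c i j * measure (\<mu> \<Otimes>\<^sub>M \<nu>) (U i \<times> V j \<inter> X))"
    if "X \<in> sets (\<mu> \<Otimes>\<^sub>M \<nu>)" for X
    unfolding measure_def[of P] eP[OF that]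
    by (intro enn2real_ennreal sum_nonneg mult_nonneg_nonneg c0) auto
  have rect: "measure (\<mu> \<Otimes>\<^sub>M \<nu>) (A \<times> B) = measure \<mu> A * measure \<nu> B"
    if "A \<in> sets \<mu>" "B \<in> sets \<nu>" for A B
    using that by (simp add: measure_def N.emeasure_pair_measure_Times enn2real_mult)
  have sumU: "(\<Sum>i\<in>I. measure \<mu> (U i \<inter> A)) = measure \<mu> A" if A: "A \<in> sets \<mu>" for A
  proof -
    have "A = (\<Union>i\<in>I. U i \<inter> A)" using sets.sets_into_space[OF A] by (auto simp: I_def U_def)
    then have "measure \<mu> A = measure \<mu> (\<Union>i\<in>I. U i \<inter> A)" by simp
    also have "\<dots> = (\<Sum>i\<in>I. measure \<mu> (U i \<inter> A))"
      using finI A by (intro M.finite_measure_finite_Union) (auto simp: disjoint_family_on_def U_def)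
    finally show ?thesis by simp
  qed
  have sumV: "(\<Sum>j\<in>J. measure \<nu> (V j \<inter> B)) = measure \<nu> B" if B: "B \<in> sets \<nu>" for B
  proof -
    have "B = (\<Union>j\<in>J. V j \<inter> B)" using sets.sets_into_space[OF B] by (auto simp: J_def V_def)
    then have "measure \<nu> B = measure \<nu> (\<Union>j\<in>J. V j \<inter> B)" by simp
    also have "\<dots> = (\<Sum>j\<in>J. measure \<nu> (V j \<inter> B))"
      using finI B by (intro N.finite_measure_finite_Union) (auto simp: disjoint_family_on_def V_def)
    finally show ?thesis by simp
  qed
  \<comment> \<open>\<open>row\<close> and \<open>col\<close> assume membership of both indices, so
    each needs an element of the other index set.\<close>
  have ne: "I \<noteq> {}" "J \<noteq> {}" using M.not_empty N.not_empty by (auto simp: I_def J_def)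
  have margX: "measure P (A \<times> space \<nu>) = measure \<mu> A" if A: "A \<in> sets \<mu>" for A
  proof -
    have "measure P (A \<times> space \<nu>) = (\<Sum>i\<in>I. \<Sum>j\<in>J. c i j * (measure \<mu> (U i \<inter> A) * b j))"
      using A sets.sets_into_space[OF UV(2)]
      by (simp add: mP Times_Int_Times rect b_def Int_absorb2)
    also have "\<dots> = (\<Sum>i\<in>I. measure \<mu> (U i \<inter> A))"
    proof (rule sum.cong[OF refl])
      fix i assume i: "i \<in> I"
      show "(\<Sum>j\<in>J. c i j * (measure \<mu> (U i \<inter> A) * b j)) = measure \<mu> (U i \<inter> A)"
      \<comment> \<open>A null cell \<open>U i\<close> contributes nothing to either side; otherwise
        the row sum \<open>a i\<close> cancels against the divisor \<open>a i\<close>.\<close>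
      proof (cases "a i = 0")
        case True
        then have "measure \<mu> (U i \<inter> A) = 0"
          using M.finite_measure_mono[of "U i \<inter> A" "U i"] A by (simp add: a_def measure_le_0_iff)
        then show ?thesis by simp
      next
        case False
        have "(\<Sum>j\<in>J. c i j * (measure \<mu> (U i \<inter> A) * b j)) =
            (\<Sum>j\<in>J. p i j) * measure \<mu> (U i \<inter> A) / a i"
          unfolding sum_distrib_right sum_divide_distrib
          using False by (intro sum.cong refl) (simp add: cab[OF i, symmetric])
        then show ?thesis using False row[OF i] ne by auto
      qed
    qed
    finally show ?thesis using sumU[OF A] by simp
  qed
  have margY: "measure P (space \<mu> \<times> B) = measure \<nu> B" if B: "B \<in> sets \<nu>" for B
  proof -
    have "measure P (space \<mu> \<times> B) = (\<Sum>j\<in>J. \<Sum>i\<in>I. c i j * (a i * measure \<nu> (V j \<inter> B)))"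
      using B sets.sets_into_space[OF UV(1)]
      by (subst sum.swap) (simp add: mP Times_Int_Times rect a_def Int_absorb2)
    also have "\<dots> = (\<Sum>j\<in>J. measure \<nu> (V j \<inter> B))"
    proof (rule sum.cong[OF refl])
      fix j assume j: "j \<in> J"
      show "(\<Sum>i\<in>I. c i j * (a i * measure \<nu> (V j \<inter> B))) = measure \<nu> (V j \<inter> B)"
      proof (cases "b j = 0")
        case True
        then have "measure \<nu> (V j \<inter> B) = 0"
          using N.finite_measure_mono[of "V j \<inter> B" "V j"] B by (simp add: b_def measure_le_0_iff)
        then show ?thesis by simp
      next
        case False
        have "(\<Sum>i\<in>I. c i j * (a i * measure \<nu> (V j \<inter> B))) =
            (\<Sum>i\<in>I. p i j) * measure \<nu> (V j \<inter> B) / b j"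
          unfolding sum_distrib_right sum_divide_distrib
          using False by (intro sum.cong refl) (simp add: cab[OF _ j, symmetric])
        then show ?thesis using False col[OF _ j] ne by auto
      qed
    qed
    finally show ?thesis using sumV[OF B] by simp
  qed
  have sp: "space P = space \<mu> \<times> space \<nu>" by (simp add: P_def space_pair_measure)
  have "emeasure P (space P) = ennreal (measure P (space P))"
    using eP[of "space P"] mP[of "space P"] by (simp add: sp)
  then have "prob_space P"
    using margX[of "space \<mu>"] by (intro prob_spaceI) (simp add: sp M.prob_space)
  then have "P \<in> couplings \<mu> \<nu>"
    using margX margY by (auto simp: couplings_def P_def)
  moreover have "measure P {(x, y) \<in> space \<mu> \<times> space \<nu>. (s x, t y) \<in> E} =
      (\<Sum>i\<in>s ` space \<mu>. \<Sum>j\<in>t ` space \<nu>. if (i, j) \<in> E then p i j else 0)" for E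
  proof -
    let ?X = "{(x, y) \<in> space \<mu> \<times> space \<nu>. (s x, t y) \<in> E}"
    \<comment> \<open>\<open>E\<close> is arbitrary, but only finitely many cells occur, so the set
      is a finite union of measurable rectangles.\<close>
    have "?X = (\<Union>i\<in>I. \<Union>j\<in>J. if (i, j) \<in> E then U i \<times> V j else {})"
      by (auto simp: I_def J_def U_def V_def split: if_splits)
    also have "\<dots> \<in> sets (\<mu> \<Otimes>\<^sub>M \<nu>)"
      using finI by (intro sets.finite_UN) auto
    finally have X: "?X \<in> sets (\<mu> \<Otimes>\<^sub>M \<nu>)" .
    have "U i \<times> V j \<inter> ?X = (if (i, j) \<in> E then U i \<times> V j else {})" for i j
      by (auto simp: U_def V_def)
    then have "measure P ?X = (\<Sum>i\<in>I. \<Sum>j\<in>J. if (i, j) \<in> E then p i j else 0)"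
      unfolding mP[OF X] using cab by (intro sum.cong refl) (auto simp: rect a_def b_def)
    then show ?thesis by (simp add: I_def J_def)
  qed
  ultimately show thesis by (rule that)
qed

text \<open>The cell masses form a finite transport problem. Its plan becomes a coupling, and its
  cover of label pairs pulls back along \<open>s\<close> and \<open>t\<close> to a cover of
  \<open>R\<close>.\<close>

lemma grid_duality:
  assumes "prob_space \<mu>" "prob_space \<nu>" "R \<in> grid \<mu> \<nu>"
  obtains P A B where "P \<in> couplings \<mu> \<nu>" "A \<in> sets \<mu>" "B \<in> sets \<nu>"
    "R \<subseteq> A \<times> space \<nu> \<union> space \<mu> \<times> B" "measure \<mu> A + measure \<nu> B \<le> measure P R"
proof -
  interpret M: prob_space \<mu> by fact
  interpret N: prob_space \<nu> by fact
  obtain s t E where R: "R = {(x, y) \<in> space \<mu> \<times> space \<nu>. (s x, t y) \<in> E}"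
    and st [measurable]: "s \<in> measurable \<mu> (count_space (UNIV :: nat set))"
      "t \<in> measurable \<nu> (count_space (UNIV :: nat set))"
    and fin: "finite (s ` space \<mu>)" "finite (t ` space \<nu>)"
    using assms(3) unfolding grid_def by blast
  let ?I = "s ` space \<mu>" and ?J = "t ` space \<nu>"
  let ?a = "\<lambda>i. measure \<mu> (s -` {i} \<inter> space \<mu>)" and ?b = "\<lambda>j. measure \<nu> (t -` {j} \<inter> space \<nu>)"
  have sum_a: "sum ?a S = measure \<mu> (s -` S \<inter> space \<mu>)" if "S \<subseteq> ?I" for S
  proof -
    have "s -` S \<inter> space \<mu> = (\<Union>i\<in>S. s -` {i} \<inter> space \<mu>)" by auto
    moreover have "finite S" using that fin finite_subset by blast
    ultimately show ?thesis
      by (simp only:, subst M.finite_measure_finite_Union) (auto simp: disjoint_family_on_def)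
  qed
  have sum_b: "sum ?b S = measure \<nu> (t -` S \<inter> space \<nu>)" if "S \<subseteq> ?J" for S
  proof -
    have "t -` S \<inter> space \<nu> = (\<Union>i\<in>S. t -` {i} \<inter> space \<nu>)" by auto
    moreover have "finite S" using that fin finite_subset by blast
    ultimately show ?thesis
      by (simp only:, subst N.finite_measure_finite_Union) (auto simp: disjoint_family_on_def)
  qed
  have full: "s -` ?I \<inter> space \<mu> = space \<mu>" "t -` ?J \<inter> space \<nu> = space \<nu>" by auto
  have "sum ?a ?I = sum ?b ?J"
    by (simp only: sum_a[OF order_refl] sum_b[OF order_refl] full M.prob_space N.prob_space)
  then obtain p S T where p: "plan ?I ?J ?a ?b p" and ST: "S \<subseteq> ?I" "T \<subseteq> ?J"
    "E \<inter> ?I \<times> ?J \<subseteq> S \<times> ?J \<union> ?I \<times> T"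
    "sum ?a S + sum ?b T \<le> (\<Sum>i\<in>?I. \<Sum>j\<in>?J. if (i, j) \<in> E then p i j else 0)"
    by (rule finite_transport_duality[OF fin measure_nonneg measure_nonneg])
  obtain P where P: "P \<in> couplings \<mu> \<nu>"
    and "\<And>E. measure P {(x, y) \<in> space \<mu> \<times> space \<nu>. (s x, t y) \<in> E} =
      (\<Sum>i\<in>?I. \<Sum>j\<in>?J. if (i, j) \<in> E then p i j else 0)"
    by (rule coupling_of_plan[OF assms(1,2) st fin p]) blast
  then have "measure P R = (\<Sum>i\<in>?I. \<Sum>j\<in>?J. if (i, j) \<in> E then p i j else 0)"
    by (simp only: R)
  moreover have "R \<subseteq> (s -` S \<inter> space \<mu>) \<times> space \<nu> \<union> space \<mu> \<times> (t -` T \<inter> space \<nu>)"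
  proof
    fix z assume "z \<in> R"
    then obtain x y where z: "z = (x, y)" "x \<in> space \<mu>" "y \<in> space \<nu>" "(s x, t y) \<in> E"
      by (auto simp: R)
    then have "s x \<in> S \<or> t y \<in> T" using ST(3) by blast
    with z show "z \<in> (s -` S \<inter> space \<mu>) \<times> space \<nu> \<union> space \<mu> \<times> (t -` T \<inter> space \<nu>)" by auto
  qed
  ultimately show thesis
    using P ST(4) unfolding sum_a[OF ST(1)] sum_b[OF ST(2)]
    by (intro that[of P "s -` S \<inter> space \<mu>" "t -` T \<inter> space \<nu>"] measurable_sets[OF st(1)]
        measurable_sets[OF st(2)]) auto
qed

section \<open>Weak duality\<close>

lemma couplings_nonempty:
  assumes "prob_space \<mu>" "prob_space \<nu>"
  shows "couplings \<mu> \<nu> \<noteq> {}"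
  using pair_measure_in_couplings[OF assms] by blast

lemma coupling_bdd:
  "bdd_above ((\<lambda>P. measure P H) ` couplings \<mu> \<nu>)" "bdd_below ((\<lambda>P. measure P H) ` couplings \<mu> \<nu>)"
  using coupling_prob_bounds by (auto intro!: bdd_aboveI2[of _ _ 1] bdd_belowI2[of _ 0])

lemma coupling_space:
  assumes "P \<in> couplings \<mu> \<nu>"
  shows "space P = space \<mu> \<times> space \<nu>"
  using assms sets_eq_imp_space_eq[of P "\<mu> \<Otimes>\<^sub>M \<nu>"] by (simp add: couplings_def space_pair_measure)

lemma coupling_marginals:
  assumes "prob_space \<mu>" "prob_space \<nu>" and P: "P \<in> couplings \<mu> \<nu>"
  shows "distr P \<mu> fst = \<mu>" "distr P \<nu> snd = \<nu>"
    and "fst \<in> measurable P \<mu>" "snd \<in> measurable P \<nu>"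
proof -
  interpret M: prob_space \<mu> by fact
  interpret N: prob_space \<nu> by fact
  interpret P: prob_space P using P by (simp add: couplings_def)
  have sP [measurable_cong]: "sets P = sets (\<mu> \<Otimes>\<^sub>M \<nu>)" using P by (simp add: couplings_def)
  show m: "fst \<in> measurable P \<mu>" "snd \<in> measurable P \<nu>" by measurable
  show "distr P \<mu> fst = \<mu>"
  proof (rule measure_eqI)
    fix A assume "A \<in> sets (distr P \<mu> fst)"
    then have A: "A \<in> sets \<mu>" by simp
    have "fst -` A \<inter> space P = A \<times> space \<nu>"
      using sets.sets_into_space[OF A] by (auto simp: coupling_space[OF P])
    then show "emeasure (distr P \<mu> fst) A = emeasure \<mu> A"
      using A P m by (simp add: emeasure_distr P.emeasure_eq_measure M.emeasure_eq_measure couplings_def)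
  qed simp
  show "distr P \<nu> snd = \<nu>"
  proof (rule measure_eqI)
    fix B assume "B \<in> sets (distr P \<nu> snd)"
    then have B: "B \<in> sets \<nu>" by simp
    have "snd -` B \<inter> space P = space \<mu> \<times> B"
      using sets.sets_into_space[OF B] by (auto simp: coupling_space[OF P])
    then show "emeasure (distr P \<nu> snd) B = emeasure \<nu> B"
      using B P m by (simp add: emeasure_distr P.emeasure_eq_measure N.emeasure_eq_measure couplings_def)
  qed simp
qed

text \<open>Each summand depends on one coordinate, so its integral is computed on a marginal. All
  couplings therefore give the sum the same integral, which is the source of weak duality.\<close>

lemma coupling_integral:
  fixes f :: "'a \<Rightarrow> real" and g :: "'b \<Rightarrow> real"
  assumes "prob_space \<mu>" "prob_space \<nu>" "P \<in> couplings \<mu> \<nu>" "integrable \<mu> f" "integrable \<nu> g"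
  shows "integrable P (\<lambda>z. f (fst z) + g (snd z))"
    and "integral\<^sup>L P (\<lambda>z. f (fst z) + g (snd z)) = integral\<^sup>L \<mu> f + integral\<^sup>L \<nu> g"
proof -
  note marg = coupling_marginals[OF assms(1-3)]
  have f: "integrable P (\<lambda>z. f (fst z))"
    by (rule integrable_distr[OF marg(3)]) (simp add: marg(1) assms(4))
  have g: "integrable P (\<lambda>z. g (snd z))"
    by (rule integrable_distr[OF marg(4)]) (simp add: marg(2) assms(5))
  show "integrable P (\<lambda>z. f (fst z) + g (snd z))" using f g by simp
  have "integral\<^sup>L P (\<lambda>z. f (fst z)) = integral\<^sup>L \<mu> f"
    using integral_distr[OF marg(3), of f] assms(4) by (simp add: marg(1))
  moreover have "integral\<^sup>L P (\<lambda>z. g (snd z)) = integral\<^sup>L \<nu> g"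
    using integral_distr[OF marg(4), of g] assms(5) by (simp add: marg(2))
  ultimately show "integral\<^sup>L P (\<lambda>z. f (fst z) + g (snd z)) = integral\<^sup>L \<mu> f + integral\<^sup>L \<nu> g"
    using f g by simp
qed

lemma coupling_indicator:
  assumes P: "P \<in> couplings \<mu> \<nu>" and "H \<in> sets (\<mu> \<Otimes>\<^sub>M \<nu>)"
  shows "integrable P (indicator H :: _ \<Rightarrow> real)" "integral\<^sup>L P (indicator H) = measure P H"
proof -
  interpret P: prob_space P using P by (simp add: couplings_def)
  have "H \<in> sets P" using assms by (simp add: couplings_def)
  then show "integrable P (indicator H :: _ \<Rightarrow> real)" "integral\<^sup>L P (indicator H) = measure P H"
    by (auto simp: less_top[symmetric] sets.Int_space_eq2)
qed

lemma measure_le_of_indicator_le: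
  fixes f :: "'a \<Rightarrow> real" and g :: "'b \<Rightarrow> real"
  assumes "prob_space \<mu>" "prob_space \<nu>" "P \<in> couplings \<mu> \<nu>" "integrable \<mu> f" "integrable \<nu> g"
    and "H \<in> sets (\<mu> \<Otimes>\<^sub>M \<nu>)"
    and "\<And>x y. x \<in> space \<mu> \<Longrightarrow> y \<in> space \<nu> \<Longrightarrow> indicator H (x, y) \<le> f x + g y"
  shows "measure P H \<le> integral\<^sup>L \<mu> f + integral\<^sup>L \<nu> g"
proof -
  have "integral\<^sup>L P (indicator H) \<le> integral\<^sup>L P (\<lambda>z. f (fst z) + g (snd z))"
    by (rule integral_mono[OF coupling_indicator(1)[OF assms(3,6)] coupling_integral(1)[OF assms(1-5)]]) (auto simp: coupling_space[OF assms(3)] assms(7))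
  then show ?thesis
    unfolding coupling_integral(2)[OF assms(1-5)] coupling_indicator(2)[OF assms(3,6)] .
qed

lemma le_measure_of_le_indicator:
  fixes f :: "'a \<Rightarrow> real" and g :: "'b \<Rightarrow> real"
  assumes "prob_space \<mu>" "prob_space \<nu>" "P \<in> couplings \<mu> \<nu>" "integrable \<mu> f" "integrable \<nu> g"
    and "H \<in> sets (\<mu> \<Otimes>\<^sub>M \<nu>)"
    and "\<And>x y. x \<in> space \<mu> \<Longrightarrow> y \<in> space \<nu> \<Longrightarrow> f x + g y \<le> indicator H (x, y)"
  shows "integral\<^sup>L \<mu> f + integral\<^sup>L \<nu> g \<le> measure P H"
proof -
  have "integral\<^sup>L P (\<lambda>z. f (fst z) + g (snd z)) \<le> integral\<^sup>L P (indicator H)"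
    by (rule integral_mono[OF coupling_integral(1)[OF assms(1-5)] coupling_indicator(1)[OF assms(3,6)]]) (auto simp: coupling_space[OF assms(3)] assms(7))
  then show ?thesis
    unfolding coupling_integral(2)[OF assms(1-5)] coupling_indicator(2)[OF assms(3,6)] .
qed

text \<open>The sets behind \<open>beta\<close> and \<open>beta_star\<close> are nonempty and
  bounded on the relevant side, so \<open>Sup\<close> and \<open>Inf\<close> obey the usual rules;
  this lemma and the next three provide them without unfolding.\<close>

lemma beta_upper:
  assumes "prob_space \<mu>" "prob_space \<nu>" "integrable \<mu> f" "integrable \<nu> g"
    and "\<And>x y. x \<in> space \<mu> \<Longrightarrow> y \<in> space \<nu> \<Longrightarrow> f x + g y \<le> indicator H (x, y)"
  shows "integral\<^sup>L \<mu> f + integral\<^sup>L \<nu> g \<le> beta \<mu> \<nu> H"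
  unfolding beta_def
  by (rule cSup_upper[OF _ beta_set_bounds(2)[OF assms(1,2)]],
      intro CollectI exI[of _ f] exI[of _ g] conjI ballI refl assms)

lemma beta_least:
  assumes "prob_space \<mu>" "prob_space \<nu>"
    and "\<And>f g. integrable \<mu> f \<Longrightarrow> integrable \<nu> g \<Longrightarrow>
      (\<And>x y. x \<in> space \<mu> \<Longrightarrow> y \<in> space \<nu> \<Longrightarrow> f x + g y \<le> indicator H (x, y)) \<Longrightarrow>
      integral\<^sup>L \<mu> f + integral\<^sup>L \<nu> g \<le> v"
  shows "beta \<mu> \<nu> H \<le> v"
  unfolding beta_def
proof (rule cSup_least)
  fix w assume "w \<in> {integral\<^sup>L \<mu> f + integral\<^sup>L \<nu> g |(f :: 'a \<Rightarrow> real) (g :: 'b \<Rightarrow> real).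
    integrable \<mu> f \<and> integrable \<nu> g \<and>
    (\<forall>x\<in>space \<mu>. \<forall>y\<in>space \<nu>. f x + g y \<le> indicator H (x, y))}"
  then show "w \<le> v"
    by (elim CollectE exE conjE) (simp add: assms(3))
qed (rule notI, use beta_set_bounds(1)[OF assms(1,2), of H] in \<open>simp only: empty_iff\<close>)

lemma beta_star_lower:
  assumes "prob_space \<mu>" "prob_space \<nu>" "integrable \<mu> f" "integrable \<nu> g"
    and "\<And>x y. x \<in> space \<mu> \<Longrightarrow> y \<in> space \<nu> \<Longrightarrow> indicator H (x, y) \<le> f x + g y"
  shows "beta_star \<mu> \<nu> H \<le> integral\<^sup>L \<mu> f + integral\<^sup>L \<nu> g"
  unfolding beta_star_def
  by (rule cInf_lower[OF _ beta_star_set_bounds(2)[OF assms(1,2)]],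
      intro CollectI exI[of _ f] exI[of _ g] conjI ballI refl assms)

lemma beta_star_greatest:
  assumes "prob_space \<mu>" "prob_space \<nu>"
    and "\<And>f g. integrable \<mu> f \<Longrightarrow> integrable \<nu> g \<Longrightarrow>
      (\<And>x y. x \<in> space \<mu> \<Longrightarrow> y \<in> space \<nu> \<Longrightarrow> indicator H (x, y) \<le> f x + g y) \<Longrightarrow>
      v \<le> integral\<^sup>L \<mu> f + integral\<^sup>L \<nu> g"
  shows "v \<le> beta_star \<mu> \<nu> H"
  unfolding beta_star_def
proof (rule cInf_greatest)
  fix w assume "w \<in> {integral\<^sup>L \<mu> f + integral\<^sup>L \<nu> g |(f :: 'a \<Rightarrow> real) (g :: 'b \<Rightarrow> real).
    integrable \<mu> f \<and> integrable \<nu> g \<and>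
    (\<forall>x\<in>space \<mu>. \<forall>y\<in>space \<nu>. f x + g y \<ge> indicator H (x, y))}"
  then show "v \<le> w"
    by (elim CollectE exE conjE) (simp add: assms(3))
qed (rule notI, use beta_star_set_bounds(1)[OF assms(1,2), of H] in \<open>simp only: empty_iff\<close>)

lemma alpha_star_le_beta_star:
  assumes "prob_space \<mu>" "prob_space \<nu>" "H \<in> sets (\<mu> \<Otimes>\<^sub>M \<nu>)"
  shows "alpha_star \<mu> \<nu> H \<le> beta_star \<mu> \<nu> H"
  unfolding alpha_star_def
  by (intro cSUP_least couplings_nonempty beta_star_greatest assms measure_le_of_indicator_le)

lemma beta_le_alpha:
  assumes "prob_space \<mu>" "prob_space \<nu>" "H \<in> sets (\<mu> \<Otimes>\<^sub>M \<nu>)"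
  shows "beta \<mu> \<nu> H \<le> alpha \<mu> \<nu> H"
  unfolding alpha_def
  by (intro cINF_greatest couplings_nonempty beta_least assms le_measure_of_le_indicator)

lemma beta_mono:
  assumes "prob_space \<mu>" "prob_space \<nu>" "H \<subseteq> H'"
  shows "beta \<mu> \<nu> H \<le> beta \<mu> \<nu> H'"
proof (intro beta_least beta_upper assms(1,2))
  fix f :: "'a \<Rightarrow> real" and g :: "'b \<Rightarrow> real" and x y
  assume "\<And>x y. x \<in> space \<mu> \<Longrightarrow> y \<in> space \<nu> \<Longrightarrow> f x + g y \<le> indicator H (x, y)"
    "x \<in> space \<mu>" "y \<in> space \<nu>"
  then have "f x + g y \<le> indicator H (x, y)" by blast
  also have "\<dots> \<le> indicator H' (x, y)" using assms(3) by (auto simp: indicator_def)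
  finally show "f x + g y \<le> indicator H' (x, y)" .
qed

section \<open>Covers of countable unions\<close>

text \<open>By the union bound, since a coupling gives the two strips exactly the masses of
  \<open>A\<close> and \<open>B\<close>. One cover thus bounds all couplings at once.\<close>

lemma coupling_cover_le:
  assumes "prob_space \<mu>" "prob_space \<nu>" "P \<in> couplings \<mu> \<nu>" "A \<in> sets \<mu>" "B \<in> sets \<nu>"
    and "H \<subseteq> A \<times> space \<nu> \<union> space \<mu> \<times> B"
  shows "measure P H \<le> measure \<mu> A + measure \<nu> B"
proof -
  interpret P: prob_space P using assms by (simp add: couplings_def)
  have rect: "A \<times> space \<nu> \<in> sets P" "space \<mu> \<times> B \<in> sets P"
    using assms by (auto simp: couplings_def)
  then have "measure P (A \<times> space \<nu> \<union> space \<mu> \<times> B) \<le>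
      measure P (A \<times> space \<nu>) + measure P (space \<mu> \<times> B)"
    by (rule measure_Un_le)
  moreover have "measure P H \<le> measure P (A \<times> space \<nu> \<union> space \<mu> \<times> B)"
    using rect by (intro P.finite_measure_mono assms(6) sets.Un)
  ultimately show ?thesis using assms(3-5) by (auto simp: couplings_def)
qed

text \<open>The optimal covers are combined in two limits: with \<open>m\<close> fixed, the window
  length \<open>k\<close> tends to infinity and gives a cover of \<open>R m\<close>; then
  \<open>m\<close> tends to infinity.\<close>

lemma increasing_union_cover:
  fixes R :: "nat \<Rightarrow> ('a \<times> 'b) set"
  assumes prob: "prob_space \<mu>" "prob_space \<nu>" and R: "\<And>n. R n \<in> grid \<mu> \<nu>" "incseq R"
  obtains A B where "A \<in> sets \<mu>" "B \<in> sets \<nu>" "(\<Union>n. R n) \<subseteq> A \<times> space \<nu> \<union> space \<mu> \<times> B"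
    "measure \<mu> A + measure \<nu> B \<le> alpha_star \<mu> \<nu> (\<Union>n. R n)"
proof -
  interpret M: prob_space \<mu> by fact
  interpret N: prob_space \<nu> by fact
  let ?cover = "\<lambda>A B. A \<times> space \<nu> \<union> space \<mu> \<times> B" and ?cost = "\<lambda>A B. measure \<mu> A + measure \<nu> B"
  let ?c = "alpha_star \<mu> \<nu> (\<Union>n. R n)"
  have "\<exists>P A B. P \<in> couplings \<mu> \<nu> \<and> A \<in> sets \<mu> \<and> B \<in> sets \<nu> \<and> R n \<subseteq> ?cover A B \<and>
      ?cost A B \<le> measure P (R n)" for n
    using grid_duality[OF prob R(1)[of n]] by metis
  then obtain P A B where P: "\<And>n. P n \<in> couplings \<mu> \<nu>"
    and [measurable]: "\<And>n. A n \<in> sets \<mu>" "\<And>n. B n \<in> sets \<nu>"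
    and cov: "\<And>n. R n \<subseteq> ?cover (A n) (B n)" and opt: "\<And>n. ?cost (A n) (B n) \<le> measure (P n) (R n)"
    by metis
  have Rsets: "R n \<in> sets (\<mu> \<Otimes>\<^sub>M \<nu>)" for n using R(1) grid_subset_sets by blast
  \<comment> \<open>The coupling \<open>P m\<close> certifies optimality: every cover of
    \<open>R m\<close> costs at least \<open>measure (P m) (R m)\<close>, which is at least the cost
    of \<open>(A m, B m)\<close>.\<close>
  have optimal: "?cost (A m) (B m) \<le> ?cost C D"
    if "C \<in> sets \<mu>" "D \<in> sets \<nu>" "R m \<subseteq> ?cover C D" for m C D
    using opt[of m] coupling_cover_le[OF prob P[of m] that] by linarith
  have le_c: "measure (P n) (R n) \<le> ?c" for n
  proof -
    interpret P: prob_space "P n" using P by (simp add: couplings_def)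
    have "(\<Union>n. R n) \<in> sets (P n)" using Rsets P[of n] by (auto simp: couplings_def)
    then have "measure (P n) (R n) \<le> measure (P n) (\<Union>n. R n)" by (intro P.finite_measure_mono) auto
    also have "\<dots> \<le> ?c" unfolding alpha_star_def by (rule cSUP_upper[OF P coupling_bdd(1)])
    finally show ?thesis .
  qed
  \<comment> \<open>The window has \<open>k + 1\<close> indices, so \<open>k = 0\<close> gives the
    optimal cover itself.\<close>
  define C where "C m k = (\<Inter>j\<in>{m..m+k}. A j)" for m k
  define D where "D m k = (\<Union>j\<in>{m..m+k}. B j)" for m k
  have CD [measurable]: "C m k \<in> sets \<mu>" "D m k \<in> sets \<nu>" for m k
    unfolding C_def D_def by (auto intro!: sets.finite_INT)
  \<comment> \<open>Peeling off the first index lets the induction compare \<open>(A m, B m)\<close>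
    with a cover of the larger set \<open>R (Suc m)\<close>; hence the generalisation over
    \<open>m\<close>.\<close>
  have step: "C m (Suc k) = A m \<inter> C (Suc m) k" "D m (Suc k) = B m \<union> D (Suc m) k" for m k
  proof -
    have "{m..m + Suc k} = insert m {Suc m..Suc m + k}" by auto
    then show "C m (Suc k) = A m \<inter> C (Suc m) k" "D m (Suc k) = B m \<union> D (Suc m) k"
      unfolding C_def D_def by simp_all
  qed
  have finite_cover: "R m \<subseteq> ?cover (C m k) (D m k) \<and> ?cost (C m k) (D m k) \<le> ?c" for m k
  proof (induction k arbitrary: m)
    case 0
    then show ?case using cov opt[of m] le_c[of m] by (auto simp: C_def D_def)
  next
    case (Suc k)
    let ?C = "C (Suc m) k" and ?D = "D (Suc m) k"
    have "R m \<subseteq> R (Suc m)" using R(2) by (simp add: incseq_SucD)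
    then have sub_cover: "R m \<subseteq> ?cover ?C ?D" using Suc[of "Suc m"] by blast
    have "R m \<subseteq> ?cover (A m \<union> ?C) (B m \<inter> ?D)" using sub_cover cov[of m] by blast
    then have "?cost (A m) (B m) \<le> ?cost (A m \<union> ?C) (B m \<inter> ?D)" by (intro optimal) auto
    \<comment> \<open>Measures are modular, so exchanging unions and intersections preserves the
      total cost of two covers. One of the new covers costs at least
      \<open>?cost (A m) (B m)\<close>, so the other costs at most
      \<open>?cost ?C ?D\<close>.\<close>
    moreover have "measure \<mu> (A m \<union> ?C) + measure \<mu> (A m \<inter> ?C) = measure \<mu> (A m) + measure \<mu> ?C"
      using M.finite_measure_Union'[of "A m" ?C] M.finite_measure_Diff'[of ?C "A m"]
      by (simp add: Int_commute)
    moreover have "measure \<nu> (B m \<union> ?D) + measure \<nu> (B m \<inter> ?D) = measure \<nu> (B m) + measure \<nu> ?D"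
      using N.finite_measure_Union'[of "B m" ?D] N.finite_measure_Diff'[of ?D "B m"]
      by (simp add: Int_commute)
    ultimately have "?cost (A m \<inter> ?C) (B m \<union> ?D) \<le> ?c" using Suc[of "Suc m"] by linarith
    then show ?case using sub_cover cov[of m] by (auto simp: step)
  qed
  define C' where "C' m = (\<Inter>k. C m k)" for m
  define D' where "D' m = (\<Union>k. D m k)" for m
  have [measurable]: "C' m \<in> sets \<mu>" "D' m \<in> sets \<nu>" for m
    unfolding C'_def D'_def by measurable
  \<comment> \<open>A point of \<open>R m\<close> with first coordinate outside \<open>C' m\<close>
    has it outside some \<open>C m k\<close>, so its second coordinate lies in
    \<open>D m k\<close>.\<close>
  have cover': "R m \<subseteq> ?cover (C' m) (D' m)" for m
    using finite_cover[of m] unfolding C'_def D'_def by blast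
  have cost': "?cost (C' m) (D' m) \<le> ?c" for m
  proof (rule LIMSEQ_le_const2)
    have "decseq (C m)" "incseq (D m)"
      unfolding decseq_def incseq_def C_def D_def
      by (intro allI impI INF_superset_mono SUP_subset_mono; auto)+
    then have "(\<lambda>k. measure \<mu> (C m k)) \<longlonglongrightarrow> measure \<mu> (C' m)" "(\<lambda>k. measure \<nu> (D m k)) \<longlonglongrightarrow> measure \<nu> (D' m)"
      unfolding C'_def D'_def
      by (auto intro!: M.finite_Lim_measure_decseq N.finite_Lim_measure_incseq)
    then show "(\<lambda>k. ?cost (C m k) (D m k)) \<longlonglongrightarrow> ?cost (C' m) (D' m)" by (rule tendsto_add)
    show "\<exists>N. \<forall>k\<ge>N. ?cost (C m k) (D m k) \<le> ?c" using finite_cover by blast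
  qed
  have tail: "{m..} = (\<Union>k. {m..m + k})" for m :: nat
    by (auto intro!: exI[of _ "_ :: nat"] le_add2)
  have C'_eq: "C' m = (\<Inter>j\<in>{m..}. A j)" and D'_eq: "D' m = (\<Union>j\<in>{m..}. B j)" for m
    unfolding C'_def D'_def C_def D_def tail by blast+
  have mono: "incseq C'" "decseq D'" by (fastforce simp: incseq_def decseq_def C'_eq D'_eq)+
  show thesis
  proof (rule that)
    show "(\<Union>m. C' m) \<in> sets \<mu>" "(\<Inter>m. D' m) \<in> sets \<nu>" by measurable
    show "(\<Union>n. R n) \<subseteq> ?cover (\<Union>m. C' m) (\<Inter>m. D' m)"
    proof
      fix z assume "z \<in> (\<Union>n. R n)"
      then obtain n where n: "z \<in> R n" by blast
      then have "z \<in> space \<mu> \<times> space \<nu>"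
        using sets.sets_into_space[OF Rsets] by (auto simp: space_pair_measure)
      then obtain x y where z: "z = (x, y)" "x \<in> space \<mu>" "y \<in> space \<nu>" by blast
      show "z \<in> ?cover (\<Union>m. C' m) (\<Inter>m. D' m)"
      proof (cases "x \<in> (\<Union>m. C' m)")
        case False
        have "y \<in> D' m" for m
        proof -
          \<comment> \<open>The index \<open>max m n\<close> is late enough for \<open>z\<close> to
            lie in \<open>R\<close>, and \<open>D'\<close> at that index is still contained in
            \<open>D' m\<close>.\<close>
          have "z \<in> R (max m n)" using n incseqD[OF R(2), of n "max m n"] by auto
          then have "y \<in> D' (max m n)" using cover'[of "max m n"] False z(1) by blast
          then show ?thesis using decseqD[OF mono(2), of m "max m n"] by auto
        qed
        with z show ?thesis by blast
      qed (use z in blast)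
    qed
    show "?cost (\<Union>m. C' m) (\<Inter>m. D' m) \<le> ?c"
    proof (rule LIMSEQ_le_const2)
      have "(\<lambda>k. measure \<mu> (C' k)) \<longlonglongrightarrow> measure \<mu> (\<Union>m. C' m)" "(\<lambda>k. measure \<nu> (D' k)) \<longlonglongrightarrow> measure \<nu> (\<Inter>m. D' m)"
        using mono by (auto intro!: M.finite_Lim_measure_incseq N.finite_Lim_measure_decseq)
      then show "(\<lambda>k. ?cost (C' k) (D' k)) \<longlonglongrightarrow> ?cost (\<Union>m. C' m) (\<Inter>m. D' m)" by (rule tendsto_add)
      show "\<exists>N. \<forall>k\<ge>N. ?cost (C' k) (D' k) \<le> ?c" using cost' by blast
    qed
  qed
qed

text \<open>Partial unions are increasing, have the same union and stay in the algebra
  \<open>grid\<close>.\<close>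

lemma union_cover:
  fixes R :: "nat \<Rightarrow> ('a \<times> 'b) set"
  assumes prob: "prob_space \<mu>" "prob_space \<nu>" and R: "\<And>n. R n \<in> grid \<mu> \<nu>"
  obtains A B where "A \<in> sets \<mu>" "B \<in> sets \<nu>" "(\<Union>n. R n) \<subseteq> A \<times> space \<nu> \<union> space \<mu> \<times> B"
    "measure \<mu> A + measure \<nu> B \<le> alpha_star \<mu> \<nu> (\<Union>n. R n)"
proof -
  interpret G: algebra "space \<mu> \<times> space \<nu>" "grid \<mu> \<nu>" by (rule algebra_grid)
  have "(\<Union>k\<le>n. R k) \<in> grid \<mu> \<nu>" for n using R by (intro G.finite_UN) auto
  moreover have "incseq (\<lambda>n. \<Union>k\<le>n. R k)" by (force simp: incseq_def)
  moreover have "(\<Union>n. \<Union>k\<le>n. R k) = (\<Union>n. R n)" by auto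
  ultimately show thesis
    using increasing_union_cover[OF prob, of "\<lambda>n. \<Union>k\<le>n. R k"] that by metis
qed

text \<open>The indicators of the two sides of the cover are admissible for
  \<open>beta_star\<close>, with the cost of the cover as value; the other inequality is weak
  duality.\<close>

lemma alpha_star_eq_beta_star_union:
  fixes R :: "nat \<Rightarrow> ('a \<times> 'b) set"
  assumes prob: "prob_space \<mu>" "prob_space \<nu>" and R: "\<And>n. R n \<in> grid \<mu> \<nu>"
  shows "alpha_star \<mu> \<nu> (\<Union>n. R n) = beta_star \<mu> \<nu> (\<Union>n. R n)"
proof (rule antisym)
  interpret M: prob_space \<mu> by fact
  interpret N: prob_space \<nu> by fact
  have "R n \<in> sets (\<mu> \<Otimes>\<^sub>M \<nu>)" for n using R grid_subset_sets by blast
  then show "alpha_star \<mu> \<nu> (\<Union>n. R n) \<le> beta_star \<mu> \<nu> (\<Union>n. R n)"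
    by (intro alpha_star_le_beta_star prob) auto
  obtain A B where AB: "A \<in> sets \<mu>" "B \<in> sets \<nu>" "(\<Union>n. R n) \<subseteq> A \<times> space \<nu> \<union> space \<mu> \<times> B"
    "measure \<mu> A + measure \<nu> B \<le> alpha_star \<mu> \<nu> (\<Union>n. R n)"
    by (rule union_cover[OF prob R])
  have int_AB: "measure \<mu> A + measure \<nu> B = integral\<^sup>L \<mu> (indicator A) + integral\<^sup>L \<nu> (indicator B)"
    using AB(1,2) by (simp add: sets.Int_space_eq2)
  have "beta_star \<mu> \<nu> (\<Union>n. R n) \<le> measure \<mu> A + measure \<nu> B"
    unfolding int_AB
  proof (rule beta_star_lower[OF prob])
    show "integrable \<mu> (indicator A :: _ \<Rightarrow> real)" "integrable \<nu> (indicator B :: _ \<Rightarrow> real)"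
      using AB(1,2) by (auto simp: less_top[symmetric])
    fix x y assume "x \<in> space \<mu>" "y \<in> space \<nu>"
    then show "(indicator (\<Union>n. R n) (x, y) :: real) \<le> indicator A x + indicator B y"
      using AB(3) by (auto simp: indicator_def)
  qed
  with AB(4) show "beta_star \<mu> \<nu> (\<Union>n. R n) \<le> alpha_star \<mu> \<nu> (\<Union>n. R n)" by linarith
qed

section \<open>Countable intersections and rectangles with null limsup\<close>

text \<open>A cover of the complement of the intersection yields an admissible pair for
  \<open>beta\<close>, and a coupling gives the two complementary sets total mass 1.\<close>

lemma alpha_eq_beta_inter:
  fixes R :: "nat \<Rightarrow> ('a \<times> 'b) set"
  assumes prob: "prob_space \<mu>" "prob_space \<nu>" and R: "\<And>n. R n \<in> grid \<mu> \<nu>"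
  shows "alpha \<mu> \<nu> (\<Inter>n. R n) = beta \<mu> \<nu> (\<Inter>n. R n)"
proof (rule antisym)
  interpret M: prob_space \<mu> by fact
  interpret N: prob_space \<nu> by fact
  interpret G: algebra "space \<mu> \<times> space \<nu>" "grid \<mu> \<nu>" by (rule algebra_grid)
  let ?K = "\<Inter>n. R n"
  have sets: "R n \<in> sets (\<mu> \<Otimes>\<^sub>M \<nu>)" for n using R grid_subset_sets by blast
  then have K: "?K \<in> sets (\<mu> \<Otimes>\<^sub>M \<nu>)" by auto
  then show "beta \<mu> \<nu> ?K \<le> alpha \<mu> \<nu> ?K" by (intro beta_le_alpha prob)
  let ?H = "\<Union>n. space \<mu> \<times> space \<nu> - R n"
  have H: "?H = space \<mu> \<times> space \<nu> - ?K" by auto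
  have compl: "space \<mu> \<times> space \<nu> - R n \<in> grid \<mu> \<nu>" for n using R by (intro G.compl_sets)
  obtain A B where AB: "A \<in> sets \<mu>" "B \<in> sets \<nu>" "?H \<subseteq> A \<times> space \<nu> \<union> space \<mu> \<times> B"
    "measure \<mu> A + measure \<nu> B \<le> alpha_star \<mu> \<nu> ?H"
    by (rule union_cover[OF prob compl])
  have int_AB: "1 - measure \<mu> A - measure \<nu> B =
      integral\<^sup>L \<mu> (\<lambda>x. 1 - indicator A x) + integral\<^sup>L \<nu> (\<lambda>y. - indicator B y)"
    using AB(1,2) by (simp add: sets.Int_space_eq2 less_top[symmetric] M.prob_space)
  have "1 - measure \<mu> A - measure \<nu> B \<le> beta \<mu> \<nu> ?K"
    unfolding int_AB
  proof (rule beta_upper[OF prob])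
    show "integrable \<mu> (\<lambda>x. 1 - indicator A x :: real)" "integrable \<nu> (\<lambda>y. - indicator B y :: real)"
      using AB(1,2) by (auto simp: less_top[symmetric])
    \<comment> \<open>Off the cover the left side is 1 and the point lies in \<open>?K\<close>; on
      the cover it is at most 0.\<close>
    fix x y assume "x \<in> space \<mu>" "y \<in> space \<nu>"
    then show "1 - indicator A x + - indicator B y \<le> (indicator ?K (x, y) :: real)"
      using AB(3) unfolding H by (auto simp: indicator_def)
  qed
  moreover have "alpha_star \<mu> \<nu> ?H \<le> 1 - alpha \<mu> \<nu> ?K"
    unfolding alpha_star_def
  proof (rule cSUP_least[OF couplings_nonempty[OF prob]])
    fix P assume P: "P \<in> couplings \<mu> \<nu>"
    then interpret P: prob_space P by (simp add: couplings_def)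
    have "measure P ?H = 1 - measure P ?K"
      using P.prob_compl[of ?K] P K unfolding H coupling_space[OF P] by (simp add: couplings_def)
    moreover have "alpha \<mu> \<nu> ?K \<le> measure P ?K"
      unfolding alpha_def by (rule cINF_lower[OF coupling_bdd(2) P])
    ultimately show "measure P ?H \<le> 1 - alpha \<mu> \<nu> ?K" by linarith
  qed
  ultimately show "alpha \<mu> \<nu> ?K \<le> beta \<mu> \<nu> ?K" using AB(4) by linarith
qed

text \<open>Duality for a finite union \<open>H n\<close> is the intersection result for a constant
  sequence. The remainder lies in a tail strip with the same mass under every coupling, so the error
  vanishes uniformly.\<close>

lemma alpha_eq_beta_rectangles:
  fixes A :: "nat \<Rightarrow> 'a set" and B :: "nat \<Rightarrow> 'b set"
  assumes prob: "prob_space \<mu>" "prob_space \<nu>"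
    and AB: "\<And>n. A n \<in> sets \<mu>" "\<And>n. B n \<in> sets \<nu>"
    and small: "measure \<mu> (\<Inter>n. \<Union>j\<in>{n<..}. A j) = 0 \<or> measure \<nu> (\<Inter>n. \<Union>j\<in>{n<..}. B j) = 0"
  shows "alpha \<mu> \<nu> (\<Union>n. A n \<times> B n) = beta \<mu> \<nu> (\<Union>n. A n \<times> B n)" (is "alpha _ _ ?H = beta _ _ ?H")
proof (rule antisym)
  interpret M: prob_space \<mu> by fact
  interpret N: prob_space \<nu> by fact
  interpret G: algebra "space \<mu> \<times> space \<nu>" "grid \<mu> \<nu>" by (rule algebra_grid)
  show "beta \<mu> \<nu> ?H \<le> alpha \<mu> \<nu> ?H"
    using AB by (intro beta_le_alpha prob sets.countable_UN) auto
  define H where "H n = (\<Union>k\<le>n. A k \<times> B k)" for n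
  have H: "H n \<in> grid \<mu> \<nu>" for n
    unfolding H_def using AB by (intro G.finite_UN Times_in_grid) auto
  \<comment> \<open>The error is the cost of a cover of \<open>?H - H n\<close>. It bounds the mass
    of that set under all couplings simultaneously and so survives the infimum.\<close>
  have approx: "alpha \<mu> \<nu> ?H \<le> beta \<mu> \<nu> ?H + (measure \<mu> C + measure \<nu> D)"
    if CD: "C \<in> sets \<mu>" "D \<in> sets \<nu>" "?H - H n \<subseteq> C \<times> space \<nu> \<union> space \<mu> \<times> D" for n C D
  proof -
    have "alpha \<mu> \<nu> ?H - (measure \<mu> C + measure \<nu> D) \<le> alpha \<mu> \<nu> (H n)"
      unfolding alpha_def[of _ _ "H n"]
    proof (rule cINF_greatest[OF couplings_nonempty[OF prob]])
      fix P assume P: "P \<in> couplings \<mu> \<nu>"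
      then interpret P: prob_space P by (simp add: couplings_def)
      have "alpha \<mu> \<nu> ?H \<le> measure P ?H"
        unfolding alpha_def by (rule cINF_lower[OF coupling_bdd(2) P])
      also have "\<dots> = measure P (H n) + measure P (?H - H n)"
      proof -
        have "?H \<in> sets P" using AB P by (auto simp: couplings_def intro!: sets.countable_UN)
        moreover have "H n \<in> sets P" using H P grid_subset_sets by (auto simp: couplings_def)
        moreover have "H n \<subseteq> ?H" by (auto simp: H_def)
        ultimately show ?thesis by (simp add: P.finite_measure_Diff)
      qed
      finally show "alpha \<mu> \<nu> ?H - (measure \<mu> C + measure \<nu> D) \<le> measure P (H n)"
        using coupling_cover_le[OF prob P CD] by linarith
    qed
    also have "alpha \<mu> \<nu> (H n) = beta \<mu> \<nu> (H n)"
      using alpha_eq_beta_inter[OF prob, of "\<lambda>_. H n"] H by simp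
    also have "\<dots> \<le> beta \<mu> \<nu> ?H" by (intro beta_mono prob) (auto simp: H_def)
    finally show ?thesis by linarith
  qed
  have sub: "A n \<subseteq> space \<mu>" "B n \<subseteq> space \<nu>" for n
    using AB[THEN sets.sets_into_space] by auto
  have rest: "?H - H n \<subseteq> (\<Union>j\<in>{n<..}. A j) \<times> (\<Union>j\<in>{n<..}. B j)" for n
  proof
    fix z assume z: "z \<in> ?H - H n"
    then obtain k where "z \<in> A k \<times> B k" by blast
    moreover from this z have "n < k" by (auto simp: H_def not_le[symmetric])
    ultimately show "z \<in> (\<Union>j\<in>{n<..}. A j) \<times> (\<Union>j\<in>{n<..}. B j)" by auto
  qed
  from small show "alpha \<mu> \<nu> ?H \<le> beta \<mu> \<nu> ?H"
  proof
    assume 0: "measure \<mu> (\<Inter>n. \<Union>j\<in>{n<..}. A j) = 0"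
    \<comment> \<open>Continuity from above: the tail unions decrease to the limsup, which is
      null.\<close>
    have "(\<lambda>n. measure \<mu> (\<Union>j\<in>{n<..}. A j)) \<longlonglongrightarrow> measure \<mu> (\<Inter>n. \<Union>j\<in>{n<..}. A j)"
      using AB by (intro M.finite_Lim_measure_decseq) (auto simp: decseq_def intro: le_less_trans)
    then have "(\<lambda>n. beta \<mu> \<nu> ?H + measure \<mu> (\<Union>j\<in>{n<..}. A j)) \<longlonglongrightarrow> beta \<mu> \<nu> ?H"
      unfolding 0 using tendsto_add[OF tendsto_const, of _ 0] by force
    moreover have "alpha \<mu> \<nu> ?H \<le> beta \<mu> \<nu> ?H + measure \<mu> (\<Union>j\<in>{n<..}. A j)" for n
    proof -
      \<comment> \<open>A single strip covers the remainder, so the other side of the cover is empty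
        and costs nothing.\<close>
      have "(\<Union>j\<in>{n<..}. A j) \<in> sets \<mu>" using AB by auto
      moreover have "?H - H n \<subseteq> (\<Union>j\<in>{n<..}. A j) \<times> space \<nu> \<union> space \<mu> \<times> {}" using rest[of n] sub by blast
      ultimately show ?thesis using approx[of "\<Union>j\<in>{n<..}. A j" "{}" n] by simp
    qed
    ultimately show ?thesis by (intro LIMSEQ_le_const[of _ _ "alpha \<mu> \<nu> ?H"]) blast+
  next
    assume 0: "measure \<nu> (\<Inter>n. \<Union>j\<in>{n<..}. B j) = 0"
    have "(\<lambda>n. measure \<nu> (\<Union>j\<in>{n<..}. B j)) \<longlonglongrightarrow> measure \<nu> (\<Inter>n. \<Union>j\<in>{n<..}. B j)"
      using AB by (intro N.finite_Lim_measure_decseq) (auto simp: decseq_def intro: le_less_trans)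
    then have "(\<lambda>n. beta \<mu> \<nu> ?H + measure \<nu> (\<Union>j\<in>{n<..}. B j)) \<longlonglongrightarrow> beta \<mu> \<nu> ?H"
      unfolding 0 using tendsto_add[OF tendsto_const, of _ 0] by force
    moreover have "alpha \<mu> \<nu> ?H \<le> beta \<mu> \<nu> ?H + measure \<nu> (\<Union>j\<in>{n<..}. B j)" for n
    proof -
      have "(\<Union>j\<in>{n<..}. B j) \<in> sets \<nu>" using AB by auto
      moreover have "?H - H n \<subseteq> {} \<times> space \<nu> \<union> space \<mu> \<times> (\<Union>j\<in>{n<..}. B j)" using rest[of n] sub by blast
      ultimately show ?thesis using approx[of "{}" "\<Union>j\<in>{n<..}. B j" n] by simp
    qed
    ultimately show ?thesis by (intro LIMSEQ_le_const[of _ _ "alpha \<mu> \<nu> ?H"]) blast+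
  qed
qed

theorem theorem4:
  fixes \<mu> :: "'a measure" and \<nu> :: "'b measure"
    and R :: "nat \<Rightarrow> ('a \<times> 'b) set" and H K :: "('a \<times> 'b) set"
  assumes "prob_space \<mu>" and "prob_space \<nu>"
    and "\<And>n. R n \<in> rect_field \<mu> \<nu>"
    and "H = (\<Union>n. R n)" and "K = (\<Inter>n. R n)"
  shows "alpha_star \<mu> \<nu> H = beta_star \<mu> \<nu> H \<and>
    alpha \<mu> \<nu> K = beta \<mu> \<nu> K \<and>
    ((\<exists>A B. (\<forall>n. A n \<in> sets \<mu>) \<and> (\<forall>n. B n \<in> sets \<nu>) \<and>
        H = (\<Union>n::nat. A n \<times> B n) \<and>
        (measure \<mu> (\<Inter>n. \<Union>j\<in>{n<..}. A j) = 0 \<or> measure \<nu> (\<Inter>n. \<Union>j\<in>{n<..}. B j) = 0))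
      \<longrightarrow> alpha \<mu> \<nu> H = beta \<mu> \<nu> H)"
proof (intro conjI impI)
  have R: "R n \<in> grid \<mu> \<nu>" for n
    using assms(3) rect_field_subset_grid by blast
  show "alpha_star \<mu> \<nu> H = beta_star \<mu> \<nu> H"
    unfolding assms(4) by (rule alpha_star_eq_beta_star_union[OF assms(1,2) R])
  show "alpha \<mu> \<nu> K = beta \<mu> \<nu> K"
    unfolding assms(5) by (rule alpha_eq_beta_inter[OF assms(1,2) R])
next
  assume "\<exists>A B. (\<forall>n. A n \<in> sets \<mu>) \<and> (\<forall>n. B n \<in> sets \<nu>) \<and>
    H = (\<Union>n::nat. A n \<times> B n) \<and>
    (measure \<mu> (\<Inter>n. \<Union>j\<in>{n<..}. A j) = 0 \<or> measure \<nu> (\<Inter>n. \<Union>j\<in>{n<..}. B j) = 0)"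
  then obtain A B where "\<And>n. A n \<in> sets \<mu>" "\<And>n. B n \<in> sets \<nu>"
    and H: "H = (\<Union>n::nat. A n \<times> B n)"
    and "measure \<mu> (\<Inter>n. \<Union>j\<in>{n<..}. A j) = 0 \<or> measure \<nu> (\<Inter>n. \<Union>j\<in>{n<..}. B j) = 0"
    by blast
  then show "alpha \<mu> \<nu> H = beta \<mu> \<nu> H"
    unfolding H by (intro alpha_eq_beta_rectangles assms(1,2))
qed

end
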